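(* Let $r\geqslant 3$ be an integer. For any positive integer $t$, there exists a constant $c_{r,t}$, depending on $r$ and $t$, such that for every integer $s\geqslant c_{r,t}$, $$\mathrm{ex}_{r}(n,K_{s,t}^{(r)})=\Theta\left(n^{r-\frac{1}{t}}\right)$$ as $n\to\infty$.
   Context: An $r$-graph is an $r$-uniform hypergraph. For an $r$-graph $\mathcal{H}$, $\mathrm{ex}_{r}(n,\mathcal{H})$ is the maximum number of edges in an $n$-vertex $r$-graph containing no copy of $\mathcal{H}$ as a (not necessarily induced) subhypergraph. The complete bipartite $r$-graph $K_{s,t}^{(r)}$ is defined as follows: let $X_{1},\ldots,X_{t}$ be $t$ pairwise disjoint sets of size $r-1$, and let $Y$ be a set of $s$ elements disjoint from $\bigcup_{i=1}^{t}X_{i}$. Then $K_{s,t}^{(r)}$ has vertex set $\left(\bigcup_{i=1}^{t}X_{i}\right)\cup Y$ and edge set $\{X_{i}\cup\{y\}: 1\leqslant i\leqslant t,\ y\in Y\}$. (For $r\geqslant 3$ and $s\neq t$, $K_{s,t}^{(r)}$ and $K_{t,s}^{(r)}$ are not isomorphic.) Asymptotic notation is for $n\to\infty$ with $r,s,t$ fixed; the implied constants are positive and do not depend on $n$. *)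

theory Defs
  imports Complex_Main "HOL-Library.Landau_Symbols"
begin

text \<open>A hypergraph is a pair of a vertex set and an edge set.\<close>

type_synonym 'a hypergraph = "'a set \<times> 'a set set"

abbreviation hverts :: "'a hypergraph \<Rightarrow> 'a set" where
  "hverts \<equiv> fst"

abbreviation hedges :: "'a hypergraph \<Rightarrow> 'a set set" where
  "hedges \<equiv> snd"

definition r_graph :: "nat \<Rightarrow> 'a hypergraph \<Rightarrow> bool" where
  "r_graph r G \<longleftrightarrow> finite (hverts G) \<and> (\<forall>e\<in>hedges G. e \<subseteq> hverts G \<and> card e = r)"

definition contains_copy :: "'a hypergraph \<Rightarrow> 'b hypergraph \<Rightarrow> bool" where
  "contains_copy G H \<longleftrightarrow>
     (\<exists>f. inj_on f (hverts H) \<and> f ` hverts H \<subseteq> hverts G \<and> (\<forall>e\<in>hedges H. f ` e \<in> hedges G))"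

text \<open>
  Host graphs live on natural numbers; every finite hypergraph is isomorphic to such a one.
  The set below is always finite. It is empty, leaving the maximum unspecified, only if even
  the edgeless graph on \<open>n\<close> vertices contains a copy of \<open>H\<close>; this cannot happen when \<open>H\<close> has
  an edge.
\<close>

definition ex :: "nat \<Rightarrow> nat \<Rightarrow> 'b hypergraph \<Rightarrow> nat" where
  "ex r n H = Max {card (hedges G) | G :: nat hypergraph.
     r_graph r G \<and> card (hverts G) = n \<and> \<not> contains_copy G H}"

text \<open>
  In \<open>K\<^bsub>s,t\<^esub>\<^bsup>(r)\<^esup>\<close> the vertices \<open>Inl (i, j)\<close> with \<open>j < r - 1\<close> make up the part \<open>X\<^sub>i\<close>,
  and the vertices \<open>Inr j\<close> with \<open>j < s\<close> make up \<open>Y\<close>. Indices start at \<open>0\<close>.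
\<close>

definition X_part :: "nat \<Rightarrow> nat \<Rightarrow> (nat \<times> nat + nat) set" where
  "X_part r i = {Inl (i, j) | j. j < r - 1}"

definition Y_part :: "nat \<Rightarrow> (nat \<times> nat + nat) set" where
  "Y_part s = {Inr j | j. j < s}"

definition complete_bipartite :: "nat \<Rightarrow> nat \<Rightarrow> nat \<Rightarrow> (nat \<times> nat + nat) hypergraph" where
  "complete_bipartite r s t =
     ((\<Union>i<t. X_part r i) \<union> Y_part s,
      {X_part r i \<union> {y} | i y. i < t \<and> y \<in> Y_part s})"

lemma finite_ex_set:
  "finite {card (hedges G) | G :: nat hypergraph.
     r_graph r G \<and> card (hverts G) = n \<and> \<not> contains_copy G H}"
proof -
  have "card (hedges G) \<le> 2 ^ card (hverts G)" if "r_graph r G" for G :: "nat hypergraph"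
  proof -
    have "finite (hverts G)" "hedges G \<subseteq> Pow (hverts G)"
      using that by (auto simp: r_graph_def)
    then show ?thesis
      by (metis card_Pow card_mono finite_Pow_iff)
  qed
  then have "{card (hedges G) | G :: nat hypergraph.
     r_graph r G \<and> card (hverts G) = n \<and> \<not> contains_copy G H} \<subseteq> {..2 ^ n}"
    by blast
  then show ?thesis
    by (rule finite_subset) simp
qed

lemma r_graph_complete_bipartite:
  assumes "r \<ge> 1"
  shows "r_graph r (complete_bipartite r s t)"
proof -
  have X: "X_part r i = (\<lambda>j. Inl (i, j)) ` {..<r - 1}" for i
    by (auto simp: X_part_def)
  have Y: "Y_part s = Inr ` {..<s}"
    by (auto simp: Y_part_def)
  have "finite (X_part r i)" "card (X_part r i) = r - 1" for i
    by (simp_all add: X card_image inj_on_def)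
  moreover have "y \<notin> X_part r i" if "y \<in> Y_part s" for y i
    using that by (auto simp: X Y)
  ultimately show ?thesis
    using assms by (fastforce simp: r_graph_def complete_bipartite_def Y)
qed

end

theory Submission
  imports
    Defs
    "HOL-Algebra.Algebraic_Closure_Type"
    "HOL-Library.Function_Algebras"
    "HOL-Library.Z2"
begin

hide_const (open) Divisibility.prime Coset.order
no_notation Polynomials.var ("X\<index>")

text \<open>
  Upper bound: count pairs of a vertex \<open>y\<close> and a \<open>t\<close>-tuple of \<open>(r-1)\<close>-sets that each form an edge
  with \<open>y\<close>. By convexity there are at least \<open>n * (|E|/n)^t\<close> of them, whereas a disjoint tuple has
  fewer than \<open>s\<close> common neighbours and the \<open>O(n^((r-1)t-1))\<close> other tuples have at most \<open>n\<close> each.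

  Lower bound: let \<open>q\<close> be a power of 2, \<open>K\<close> the field of size \<open>q^t\<close>, \<open>L\<close> its extension of degree \<open>r\<close>
  with \<open>K\<close>-basis \<open>\<theta>\<^sub>i\<close>, and let \<open>N\<close> be the norm from \<open>L\<close> to the field of size \<open>q\<close>. Join
  \<open>(x\<^sub>0, \<dots>, x\<^bsub>r-1\<^esub>)\<close> in the \<open>r\<close>-partite \<open>r\<close>-graph with all parts equal to \<open>K\<close> if
  \<open>N (\<Sum>i. \<theta>\<^sub>i x\<^sub>i) = c\<close>, for a popular \<open>c\<close>. As a condition on the coordinate \<open>y = x\<^sub>j\<close> alone this says
  \<open>N (y - \<alpha>) = c / N \<theta>\<^sub>j\<close> where \<open>\<alpha> \<in> L\<close> determines the other coordinates. With \<open>y\<^sub>k = y^(q^k)\<close> it becomes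
  \<open>\<Prod>k<t. P\<^sub>k (y\<^sub>k) = b\<close>, where \<open>P\<^sub>k\<close> is the product of \<open>Y - \<beta>\<close> over the Frobenius images \<open>\<beta>\<close> of
  \<open>\<alpha>^(q^k)\<close> over \<open>K\<close>. For pairwise nonconjugate \<open>\<alpha>\<close> these polynomials are pairwise coprime, and then \<open>t\<close>
  such equations have boundedly many common solutions, an elementary variant of the key lemma for norm
  graphs of Kollar, Ronyai and Szabo. Conjugate \<open>\<alpha>\<close> are avoided by colouring each conjugacy class with
  \<open>r\<close> colours, separately for every \<open>j\<close>, and keeping only the most popular vector of colours.
\<close>

section \<open>Systems of product equations\<close>

text \<open>Partial fractions with control of degrees: a Bezout identity splits off one
  \<open>P x\<close>, and the quotient is treated by induction. The bound on \<open>a i\<close> is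
  the one that keeps every summand within degree \<open>N\<close>.\<close>

lemma coprime_polys_generate:
  fixes P :: "'i \<Rightarrow> 'a::field_gcd poly"
  assumes "finite I" "I \<noteq> {}"
    and "\<And>i. i \<in> I \<Longrightarrow> degree (P i) = d" "\<And>i. i \<in> I \<Longrightarrow> P i \<noteq> 0"
    and "\<And>i j. i \<in> I \<Longrightarrow> j \<in> I \<Longrightarrow> i \<noteq> j \<Longrightarrow> coprime (P i) (P j)"
    and "degree p \<le> N" "card I * d \<le> N"
  shows "\<exists>a. (\<forall>i\<in>I. degree (a i) \<le> N - (card I - 1) * d) \<and> p = (\<Sum>i\<in>I. a i * (\<Prod>j\<in>I - {i}. P j))"
  using assms
proof (induction I arbitrary: p N rule: finite_ne_induct)
  case (singleton x)
  then show ?case by (intro exI[of _ "\<lambda>_. p"]) auto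
next
  case (insert x I)
  define Q where "Q = (\<Prod>j\<in>I. P j)"
  have P0: "P i \<noteq> 0" if "i \<in> I" for i using insert.prems that by auto
  have degQ: "degree Q = card I * d"
    unfolding Q_def using insert.prems P0 by (subst degree_prod_eq_sum_degree) auto
  have "coprime (P x) Q"
    unfolding Q_def
  proof (rule prod_coprime_right)
    fix i assume "i \<in> I"
    moreover from this have "x \<noteq> i" using insert.hyps by auto
    ultimately show "coprime (P x) (P i)" using insert.prems(3) by blast
  qed
  then obtain u v where uv: "u * P x + v * Q = 1"
    using bezout_coefficients_fst_snd[of "P x" Q] by (metis coprime_imp_gcd_eq_1)
  \<comment> \<open>\<open>v\<close> inverts \<open>Q\<close> modulo \<open>P x\<close>, so
    \<open>B * Q\<close> and \<open>p\<close> agree modulo \<open>P x\<close>; taking the remainder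
    keeps the degree of \<open>B\<close> small.\<close>
  define B where "B = (p * v) mod P x"
  have degB: "degree B \<le> d"
    unfolding B_def using insert.prems by (metis degree_mod_less degree_0 insertI1 le0 less_imp_le)
  have "P x dvd p - B * Q"
  proof -
    have "p - B * Q = p * (u * P x + v * Q) - B * Q" by (simp add: uv)
    also have "\<dots> = P x * (p * u) + (p * v - B) * Q" by (simp add: algebra_simps)
    finally have "p - B * Q = P x * (p * u) + (p * v - B) * Q" .
    moreover have "P x dvd p * v - B" unfolding B_def by (simp add: minus_mod_eq_mult_div)
    ultimately show ?thesis by simp
  qed
  then obtain A where A: "p - B * Q = P x * A" by (auto simp: dvd_def)
  have N: "card I * d + d \<le> N" using insert by simp
  have "degree (B * Q) \<le> N"
    using degree_mult_le[of B Q] degB degQ N by linarith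
  then have "degree (P x * A) \<le> N"
    using insert.prems by (metis A degree_diff_le)
  then have degA: "degree A \<le> N - d"
    using insert.prems by (cases "A = 0") (auto simp: degree_mult_eq)
  \<comment> \<open>Dividing by \<open>P x\<close> has lowered the degree bound to
    \<open>N - d\<close>, and one polynomial fewer remains.\<close>
  have "\<exists>a. (\<forall>i\<in>I. degree (a i) \<le> (N - d) - (card I - 1) * d) \<and> A = (\<Sum>i\<in>I. a i * (\<Prod>j\<in>I - {i}. P j))"
    by (rule insert.IH) (use insert.prems degA N in auto)
  then obtain a where a: "\<And>i. i \<in> I \<Longrightarrow> degree (a i) \<le> (N - d) - (card I - 1) * d"
    "A = (\<Sum>i\<in>I. a i * (\<Prod>j\<in>I - {i}. P j))" by blast
  have cI: "card I \<ge> 1" using insert.hyps by (simp add: Suc_leI card_gt_0_iff)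
  have eq: "(N - d) - (card I - 1) * d = N - card I * d"
    using cI by (cases "card I") auto
  let ?a = "\<lambda>i. if i = x then B else a i"
  have "p = B * Q + P x * A" using A by (simp add: algebra_simps)
  also have "P x * A = (\<Sum>i\<in>I. a i * (P x * (\<Prod>j\<in>I - {i}. P j)))"
    unfolding a(2) by (simp add: sum_distrib_left mult_ac)
  also have "\<dots> = (\<Sum>i\<in>I. ?a i * (\<Prod>j\<in>insert x I - {i}. P j))"
  proof (rule sum.cong)
    fix i assume i: "i \<in> I"
    then have "insert x I - {i} = insert x (I - {i})" using insert.hyps by auto
    then have "(\<Prod>j\<in>insert x I - {i}. P j) = P x * (\<Prod>j\<in>I - {i}. P j)"
      using insert.hyps by simp
    then show "a i * (P x * (\<Prod>j\<in>I - {i}. P j)) = ?a i * (\<Prod>j\<in>insert x I - {i}. P j)"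
      using i insert.hyps by auto
  qed simp
  also have "B * Q = ?a x * (\<Prod>j\<in>insert x I - {x}. P j)"
    using insert.hyps by (simp add: Q_def)
  finally have "p = (\<Sum>i\<in>insert x I. ?a i * (\<Prod>j\<in>insert x I - {i}. P j))"
    using insert.hyps by simp
  moreover have "\<forall>i\<in>insert x I. degree (?a i) \<le> N - (card (insert x I) - 1) * d"
    using a(1) eq degB N insert.hyps by auto
  ultimately show ?case by (intro exI[of _ ?a]) blast
qed

text \<open>
  Polynomials in the coordinates \<open>u k\<close>, of degree at most \<open>M k\<close> in \<open>u k\<close>, treated as functions so that
  reducing them modulo a system of equations becomes equality on its solution set. A coordinate is
  absent when \<open>M k = 0\<close>.
\<close>

inductive_set bounded_degree ::
  "'k set \<Rightarrow> ('k \<Rightarrow> 'z \<Rightarrow> 'a::comm_ring_1) \<Rightarrow> ('k \<Rightarrow> nat) \<Rightarrow> ('z \<Rightarrow> 'a) set"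
  for K u M where
  monomial: "(\<And>k. k \<in> K \<Longrightarrow> e k \<le> M k) \<Longrightarrow> (\<lambda>z. c * (\<Prod>k\<in>K. u k z ^ e k)) \<in> bounded_degree K u M"
| add: "f \<in> bounded_degree K u M \<Longrightarrow> g \<in> bounded_degree K u M \<Longrightarrow> (\<lambda>z. f z + g z) \<in> bounded_degree K u M"

section \<open>Closure properties of the functions of bounded degree\<close>

lemma bounded_degree_zero: "(\<lambda>z. 0) \<in> bounded_degree K u M"
  using monomial[of K "\<lambda>_. 0" M 0 u] by simp

lemma bounded_degree_const: "(\<lambda>z. c) \<in> bounded_degree K u M"
  using monomial[of K "\<lambda>_. 0" M c u] by simp

lemma bounded_degree_sum:
  "(\<And>i. i \<in> I \<Longrightarrow> f i \<in> bounded_degree K u M) \<Longrightarrow> (\<lambda>z. \<Sum>i\<in>I. f i z) \<in> bounded_degree K u M"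
  by (induction I rule: infinite_finite_induct) (auto intro: bounded_degree_zero add)

lemma bounded_degree_mult:
  assumes "f \<in> bounded_degree K u M" "g \<in> bounded_degree K u M'"
  shows "(\<lambda>z. f z * g z) \<in> bounded_degree K u (\<lambda>k. M k + M' k)"
  using assms
proof (induction rule: bounded_degree.induct)
  case (monomial e c)
  show ?case using monomial.prems
  proof (induction rule: bounded_degree.induct)
    case (monomial e' c')
    have "(\<lambda>z. (c * c') * (\<Prod>k\<in>K. u k z ^ (e k + e' k))) \<in> bounded_degree K u (\<lambda>k. M k + M' k)"
      by (rule bounded_degree.monomial) (meson add_mono monomial \<open>\<And>k. k \<in> K \<Longrightarrow> e k \<le> M k\<close>)
    then show ?case by (simp add: power_add prod.distrib mult_ac)
  next
    case (add f g)
    from bounded_degree.add[OF add.IH] show ?case by (simp add: distrib_left)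
  qed
next
  case (add f g)
  from bounded_degree.add[OF add.IH(1)[OF add.prems] add.IH(2)[OF add.prems]]
  show ?case by (simp add: distrib_right)
qed

lemma bounded_degree_mono:
  assumes "f \<in> bounded_degree K u M" "\<And>k. k \<in> K \<Longrightarrow> M k \<le> M' k"
  shows "f \<in> bounded_degree K u M'"
  using assms(1)
proof (induction rule: bounded_degree.induct)
  case (monomial e c)
  show ?case by (rule bounded_degree.monomial) (meson assms(2) monomial order_trans)
qed (rule bounded_degree.add)

lemma bounded_degree_mult':
  assumes "f \<in> bounded_degree K u M" "g \<in> bounded_degree K u M'"
    and "\<And>k. k \<in> K \<Longrightarrow> M k + M' k \<le> N k"
  shows "(\<lambda>z. f z * g z) \<in> bounded_degree K u N"
  by (rule bounded_degree_mono[OF bounded_degree_mult[OF assms(1,2)]]) (rule assms(3))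

lemma bounded_degree_power:
  assumes "finite K" "k \<in> K" "n \<le> M k"
  shows "(\<lambda>z. u k z ^ n) \<in> bounded_degree K u M"
proof -
  have "(\<Prod>j\<in>K. u j z ^ (if j = k then n else 0)) = u k z ^ n" for z
  proof -
    have "(\<Prod>j\<in>K. u j z ^ (if j = k then n else 0)) = (\<Prod>j\<in>K. if j = k then u j z ^ n else 1)"
      by (rule prod.cong) auto
    then show ?thesis using assms by (simp add: prod.delta)
  qed
  with monomial[of K "\<lambda>j. if j = k then n else 0" M 1 u] assms show ?thesis by simp
qed

lemma bounded_degree_poly:
  assumes "finite K" "k \<in> K" "degree p \<le> M k"
  shows "(\<lambda>z. poly p (u k z)) \<in> bounded_degree K u M"
proof -
  have "(\<lambda>z. coeff p i * u k z ^ i) \<in> bounded_degree K u M" if "i \<in> {..degree p}" for i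
    by (rule bounded_degree_mult'[of _ K u "\<lambda>_. 0" _ M, OF bounded_degree_const bounded_degree_power])
      (use assms that in auto)
  from bounded_degree_sum[of "{..degree p}", OF this] show ?thesis by (simp add: poly_altdef)
qed

lemma bounded_degree_prod_poly:
  assumes "finite K" "S \<subseteq> K" "\<And>k. k \<in> S \<Longrightarrow> degree (p k) \<le> M k"
  shows "(\<lambda>z. \<Prod>k\<in>S. poly (p k) (u k z)) \<in> bounded_degree K u (\<lambda>k. if k \<in> S then M k else 0)"
proof -
  have "finite S" using assms finite_subset by blast
  then show ?thesis using assms(2,3)
  proof (induction S)
    case empty
    then show ?case by (simp add: bounded_degree_const)
  next
    case (insert j S)
    have "(\<lambda>z. poly (p j) (u j z) * (\<Prod>k\<in>S. poly (p k) (u k z)))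
      \<in> bounded_degree K u (\<lambda>k. if k \<in> insert j S then M k else 0)"
      by (rule bounded_degree_mult'[OF bounded_degree_poly[of K j _ "\<lambda>k. if k = j then M k else 0"] insert.IH])
        (use assms(1) insert in auto)
    then show ?case using insert.hyps by simp
  qed
qed

text \<open>
  One product more than there are coordinates, so the products have no common zero; this also holds at
  infinity, which is what bounds the degrees of the coefficients.
\<close>

lemma monomial_in_ideal_of_products:
  fixes P :: "'i \<Rightarrow> 'k \<Rightarrow> 'a::field_gcd poly"
  assumes "finite K" "finite S" "S \<subseteq> K" "finite I" "card I = card S + 1"
    and "\<And>i k. i \<in> I \<Longrightarrow> k \<in> S \<Longrightarrow> degree (P i k) = d"
    and "\<And>i k. i \<in> I \<Longrightarrow> k \<in> S \<Longrightarrow> P i k \<noteq> 0"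
    and "\<And>i j k. i \<in> I \<Longrightarrow> j \<in> I \<Longrightarrow> i \<noteq> j \<Longrightarrow> k \<in> S \<Longrightarrow> coprime (P i k) (P j k)"
    and "\<And>k. k \<in> S \<Longrightarrow> card I * d \<le> M k" "\<And>k. k \<in> S \<Longrightarrow> e k \<le> M k"
  shows "\<exists>c. (\<forall>i\<in>I. c i \<in> bounded_degree K u (\<lambda>k. if k \<in> S then M k - d else 0)) \<and>
    (\<forall>z. (\<Prod>k\<in>S. u k z ^ e k) = (\<Sum>i\<in>I. c i z * (\<Prod>k\<in>S. poly (P i k) (u k z))))"
  using assms(2-)
proof (induction S arbitrary: I rule: finite_induct)
  case empty
  then obtain i where "I = {i}" by (auto simp: card_1_singleton_iff)
  then show ?case by (intro exI[of _ "\<lambda>_ _. 1"]) (auto intro: bounded_degree_const)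
next
  case (insert n S)
  note fI = \<open>finite I\<close>
  have cI: "card I = card S + 2" using insert by simp
  then have "I \<noteq> {}" by auto
  let ?D = "\<lambda>k. if k \<in> S then M k - d else 0"
  \<comment> \<open>In the coordinate \<open>n\<close> alone, the power is spread over the products
    that omit one index.\<close>
  have "degree (monom (1::'a) (e n)) \<le> M n" using insert.prems by (simp add: degree_monom_eq)
  then have "\<exists>a. (\<forall>i\<in>I. degree (a i) \<le> M n - (card I - 1) * d) \<and>
      monom 1 (e n) = (\<Sum>i\<in>I. a i * (\<Prod>j\<in>I - {i}. P j n))"
    by (intro coprime_polys_generate) (use insert.prems \<open>I \<noteq> {}\<close> in auto)
  then obtain a where a: "\<And>i. i \<in> I \<Longrightarrow> degree (a i) \<le> M n - (card I - 1) * d"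
    and am: "monom 1 (e n) = (\<Sum>i\<in>I. a i * (\<Prod>j\<in>I - {i}. P j n))" by blast
  \<comment> \<open>Omitting \<open>i0\<close> leaves one index more than there are coordinates in
    \<open>S\<close>, as the induction hypothesis demands.\<close>
  have "\<exists>c. (\<forall>i\<in>I - {i0}. c i \<in> bounded_degree K u ?D) \<and>
    (\<forall>z. (\<Prod>k\<in>S. u k z ^ e k) = (\<Sum>i\<in>I - {i0}. c i z * (\<Prod>k\<in>S. poly (P i k) (u k z))))"
    if "i0 \<in> I" for i0
  proof (rule insert.IH)
    have cI': "card (I - {i0}) \<le> card I" using fI by (intro card_mono) auto
    show "card (I - {i0}) * d \<le> M k" if "k \<in> S" for k
      by (rule order_trans[OF mult_le_mono1[OF cI']]) (use insert.prems(7)[of k] that in simp)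
  qed (use insert.prems that cI in auto)
  then have "\<exists>c. \<forall>i0\<in>I. (\<forall>i\<in>I - {i0}. c i0 i \<in> bounded_degree K u ?D) \<and>
    (\<forall>z. (\<Prod>k\<in>S. u k z ^ e k) = (\<Sum>i\<in>I - {i0}. c i0 i z * (\<Prod>k\<in>S. poly (P i k) (u k z))))"
    by (intro bchoice ballI)
  then obtain c where c_all: "\<forall>i0\<in>I. (\<forall>i\<in>I - {i0}. c i0 i \<in> bounded_degree K u ?D) \<and>
    (\<forall>z. (\<Prod>k\<in>S. u k z ^ e k) = (\<Sum>i\<in>I - {i0}. c i0 i z * (\<Prod>k\<in>S. poly (P i k) (u k z))))"
    by blast
  have c: "c i0 i \<in> bounded_degree K u ?D" if "i0 \<in> I" "i \<in> I" "i \<noteq> i0" for i0 i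
    using c_all that by blast
  have cm: "(\<Prod>k\<in>S. u k z ^ e k) = (\<Sum>i\<in>I - {i0}. c i0 i z * (\<Prod>k\<in>S. poly (P i k) (u k z)))"
    if "i0 \<in> I" for i0 z
    using c_all that by blast
  \<comment> \<open>The product over \<open>I - {i0}\<close> contains \<open>P i n\<close> for every
    \<open>i\<close> other than \<open>i0\<close>. Joined to the product over \<open>S\<close> that
    belongs to \<open>i\<close>, this factor completes it to a product over
    \<open>insert n S\<close>; \<open>C i\<close> collects what is left.\<close>
  define C where "C = (\<lambda>i z. \<Sum>i0\<in>I - {i}. poly (a i0 * (\<Prod>j\<in>I - {i0} - {i}. P j n)) (u n z) * c i0 i z)"
  have "C i \<in> bounded_degree K u (\<lambda>k. if k \<in> insert n S then M k - d else 0)" if i: "i \<in> I" for i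
    unfolding C_def
  proof (rule bounded_degree_sum)
    fix i0 assume i0: "i0 \<in> I - {i}"
    have "degree (\<Prod>j\<in>I - {i0} - {i}. P j n) = (\<Sum>j\<in>I - {i0} - {i}. degree (P j n))"
      using insert.prems by (intro degree_prod_eq_sum_degree) auto
    also have "\<dots> = (\<Sum>j\<in>I - {i0} - {i}. d)" using insert.prems by (intro sum.cong) auto
    also have "\<dots> = card S * d"
    proof -
      have "card (I - {i0}) = card S + 1" using i0 cI by (subst card_Diff_singleton) auto
      then have "card (I - {i0} - {i}) = card S" using i i0 by (subst card_Diff_singleton) auto
      then show ?thesis by simp
    qed
    finally have "degree (a i0 * (\<Prod>j\<in>I - {i0} - {i}. P j n)) \<le> (M n - (card I - 1) * d) + card S * d"
      using degree_mult_le[of "a i0" "\<Prod>j\<in>I - {i0} - {i}. P j n"] a[of i0] i0 by auto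
    \<comment> \<open>Since \<open>card I - 1 = card S + 1\<close>, exactly one \<open>d\<close> is
      saved, and \<open>M n\<close> is large enough for the subtractions not to truncate.\<close>
    also have "\<dots> = M n - d"
    proof -
      have "(card S + 2) * d \<le> M n" using insert.prems(7)[of n] cI by simp
      then show ?thesis using cI by (simp add: algebra_simps)
    qed
    finally show "(\<lambda>z. poly (a i0 * (\<Prod>j\<in>I - {i0} - {i}. P j n)) (u n z) * c i0 i z)
        \<in> bounded_degree K u (\<lambda>k. if k \<in> insert n S then M k - d else 0)"
      by (intro bounded_degree_mult'[OF bounded_degree_poly[of K n _ "\<lambda>k. if k = n then M k - d else 0"] c])
        (use insert.prems insert.hyps assms(1) i i0 in \<open>auto split: if_splits\<close>)
  qed
  moreover have "(\<Prod>k\<in>insert n S. u k z ^ e k) = (\<Sum>i\<in>I. C i z * (\<Prod>k\<in>insert n S. poly (P i k) (u k z)))" for z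
  proof -
    define h where "h = (\<lambda>i. \<Prod>k\<in>S. poly (P i k) (u k z))"
    define A where "A = (\<lambda>i0. poly (a i0) (u n z))"
    define p where "p = (\<lambda>i. poly (P i n) (u n z))"
    have "u n z ^ e n = poly (monom 1 (e n)) (u n z)" by (simp add: poly_monom)
    also have "\<dots> = (\<Sum>i0\<in>I. A i0 * (\<Prod>j\<in>I - {i0}. p j))"
      unfolding am by (simp add: poly_sum poly_prod A_def p_def)
    finally have "(\<Prod>k\<in>insert n S. u k z ^ e k) = (\<Sum>i0\<in>I. A i0 * (\<Prod>j\<in>I - {i0}. p j)) * (\<Prod>k\<in>S. u k z ^ e k)"
      using insert.hyps by simp
    also have "\<dots> = (\<Sum>i0\<in>I. A i0 * (\<Prod>j\<in>I - {i0}. p j) * (\<Sum>i\<in>I - {i0}. c i0 i z * h i))"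
      unfolding sum_distrib_right by (rule sum.cong) (auto simp: cm h_def)
    also have "\<dots> = (\<Sum>i0\<in>I. \<Sum>i\<in>I - {i0}. A i0 * (\<Prod>j\<in>I - {i0} - {i}. p j) * c i0 i z * (h i * p i))"
      unfolding sum_distrib_left
    proof (intro sum.cong refl)
      fix i0 i assume "i0 \<in> I" "i \<in> I - {i0}"
      then have "(\<Prod>j\<in>I - {i0}. p j) = p i * (\<Prod>j\<in>I - {i0} - {i}. p j)"
        using fI by (intro prod.remove) auto
      then show "A i0 * (\<Prod>j\<in>I - {i0}. p j) * (c i0 i z * h i) = A i0 * (\<Prod>j\<in>I - {i0} - {i}. p j) * c i0 i z * (h i * p i)"
        by (simp add: mult_ac)
    qed
    also have "\<dots> = (\<Sum>i\<in>I. \<Sum>i0\<in>I - {i}. A i0 * (\<Prod>j\<in>I - {i0} - {i}. p j) * c i0 i z * (h i * p i))"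
    proof -
      have "(\<Sum>i0\<in>I. \<Sum>i\<in>I - {i0}. f i0 i) = (\<Sum>i\<in>I. \<Sum>i0\<in>I - {i}. f i0 i)" for f :: "'i \<Rightarrow> 'i \<Rightarrow> 'a"
        by (subst (1 2) sum.Sigma) (use fI in \<open>auto intro!: sum.reindex_bij_witness[of _ "\<lambda>(a,b). (b,a)" "\<lambda>(a,b). (b,a)"]\<close>)
      then show ?thesis .
    qed
    also have "\<dots> = (\<Sum>i\<in>I. C i z * (h i * p i))"
      unfolding C_def by (simp add: sum_distrib_right poly_prod A_def p_def)
    also have "\<dots> = (\<Sum>i\<in>I. C i z * (\<Prod>k\<in>insert n S. poly (P i k) (u k z)))"
      using insert.hyps by (simp add: h_def p_def mult_ac)
    finally show ?thesis .
  qed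
  ultimately show ?case by blast
qed

text \<open>On \<open>Z\<close> an excess power of \<open>u j\<close> can be traded for lower ones.
  The other coordinates are one fewer than the equations, so their monomial is a combination of the
  products over \<open>K - {j}\<close>. Each such product, multiplied by a high power of
  \<open>u j\<close>, is rewritten by its equation, as \<open>P i j\<close> is monic. The
  coefficients have degree at most \<open>M k - d\<close>, which leaves room for the products that
  return with the lower terms.\<close>

lemma bounded_degree_reduce:
  fixes P :: "'i \<Rightarrow> 'k \<Rightarrow> 'a::field_gcd poly"
  assumes K: "finite K" "j \<in> K" and I: "finite I" "card I = card K" and d: "d > 0"
    and deg: "\<And>i k. i \<in> I \<Longrightarrow> k \<in> K \<Longrightarrow> degree (P i k) = d"
    and monic: "\<And>i k. i \<in> I \<Longrightarrow> k \<in> K \<Longrightarrow> lead_coeff (P i k) = 1"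
    and cop: "\<And>i i' k. i \<in> I \<Longrightarrow> i' \<in> I \<Longrightarrow> i \<noteq> i' \<Longrightarrow> k \<in> K \<Longrightarrow> coprime (P i k) (P i' k)"
    and M: "\<And>k. k \<in> K \<Longrightarrow> card I * d \<le> M k"
    and Z: "\<And>i z. i \<in> I \<Longrightarrow> z \<in> Z \<Longrightarrow> (\<Prod>k\<in>K. poly (P i k) (u k z)) = b i"
    and f: "f \<in> bounded_degree K u (M(j := Suc (M j)))"
  shows "\<exists>g\<in>bounded_degree K u M. \<forall>z\<in>Z. f z = g z"
  using f
proof (induction rule: bounded_degree.induct)
  case (add f1 f2)
  then obtain g1 g2 where "g1 \<in> bounded_degree K u M" "g2 \<in> bounded_degree K u M"
    "\<forall>z\<in>Z. f1 z = g1 z" "\<forall>z\<in>Z. f2 z = g2 z" by blast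
  then show ?case by (intro bexI[of _ "\<lambda>z. g1 z + g2 z"] bounded_degree.add) auto
next
  case (monomial e c)
  show ?case
  proof (cases "e j \<le> M j")
    case True
    have "e k \<le> M k" if "k \<in> K" for k
      using monomial[OF that] True by (cases "k = j") auto
    then show ?thesis by (intro bexI[OF _ bounded_degree.monomial]) auto
  next
    case False
    then have ej: "e j = Suc (M j)" using monomial[OF K(2)] by simp
    let ?S = "K - {j}"
    have cS: "card I = card ?S + 1" using K I card_gt_0_iff[of K] by (auto simp: card_Diff_singleton)
    have eS: "e k \<le> M k" if "k \<in> ?S" for k using monomial[of k] that by simp
    have "\<exists>a. (\<forall>i\<in>I. a i \<in> bounded_degree K u (\<lambda>k. if k \<in> ?S then M k - d else 0)) \<and>
      (\<forall>z. (\<Prod>k\<in>?S. u k z ^ e k) = (\<Sum>i\<in>I. a i z * (\<Prod>k\<in>?S. poly (P i k) (u k z))))"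
    proof (rule monomial_in_ideal_of_products)
      show "P i k \<noteq> 0" if "i \<in> I" "k \<in> ?S" for i k using monic[of i k] that by auto
    qed (use K I cS deg cop M eS in auto)
    then obtain a where a: "\<And>i. i \<in> I \<Longrightarrow> a i \<in> bounded_degree K u (\<lambda>k. if k \<in> ?S then M k - d else 0)"
      and am: "\<And>z. (\<Prod>k\<in>?S. u k z ^ e k) = (\<Sum>i\<in>I. a i z * (\<Prod>k\<in>?S. poly (P i k) (u k z)))"
      by blast
    have dM: "d \<le> M k" if "k \<in> K" for k
    proof -
      have "1 \<le> card I" using cS by simp
      then have "d \<le> card I * d" by simp
      then show ?thesis using M[OF that] by linarith
    qed
    define low where "low = (\<lambda>i. P i j - monom 1 d)"
    have deglow: "degree (low i) \<le> d - 1" if "i \<in> I" for i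
    proof (rule degree_le, intro allI impI)
      fix n assume "d - 1 < n"
      then consider "n = d" | "n > d" using d by linarith
      then show "coeff (low i) n = 0"
      proof cases
        case 1
        then show ?thesis using deg[OF that K(2)] monic[OF that K(2)] by (simp add: low_def)
      next
        case 2
        then show ?thesis using deg[OF that K(2)] by (simp add: low_def coeff_eq_0)
      qed
    qed
    \<comment> \<open>On \<open>Z\<close>, \<open>u j ^ d * ?h i\<close> equals \<open>b i\<close> up to terms of lower degree in \<open>u j\<close>.\<close>
    let ?h = "\<lambda>i z. \<Prod>k\<in>?S. poly (P i k) (u k z)"
    let ?q = "\<lambda>i. monom 1 (Suc (M j) - d) * low i"
    define g where "g = (\<lambda>z. \<Sum>i\<in>I. c * (a i z * (b i * u j z ^ (Suc (M j) - d))) - c * (a i z * (?h i z * poly (?q i) (u j z))))"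
    have degq: "degree (?q i) \<le> M j" if "i \<in> I" for i
    proof -
      have "degree (?q i) \<le> (Suc (M j) - d) + (d - 1)"
        using degree_mult_le[of "monom (1::'a) (Suc (M j) - d)" "low i"] deglow[OF that]
        by (simp add: degree_monom_eq)
      then show ?thesis using d dM[OF K(2)] by simp
    qed
    have smult: "(\<lambda>z. x * f z) \<in> bounded_degree K u M" if "f \<in> bounded_degree K u M" for f x
      by (rule bounded_degree_mult'[OF bounded_degree_const[of _ K u "\<lambda>_. 0"] that]) simp
    have "g \<in> bounded_degree K u M"
      unfolding g_def
    proof (rule bounded_degree_sum)
      fix i assume i: "i \<in> I"
      have 1: "(\<lambda>z. a i z * (b i * u j z ^ (Suc (M j) - d))) \<in> bounded_degree K u M"
      proof -
        have "(\<lambda>z. b i * u j z ^ (Suc (M j) - d)) \<in> bounded_degree K u (\<lambda>k. 0 + (if k = j then M j else 0))"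
          by (intro bounded_degree_mult bounded_degree_const bounded_degree_power) (use K d in auto)
        from bounded_degree_mult'[OF a[OF i] this] show ?thesis by (auto simp: K)
      qed
      have h: "?h i \<in> bounded_degree K u (\<lambda>k. if k \<in> ?S then d else 0)"
        using bounded_degree_prod_poly[of K ?S "P i" "\<lambda>_. d" u] K deg i by auto
      have q: "(\<lambda>z. poly (?q i) (u j z)) \<in> bounded_degree K u (\<lambda>k. if k = j then M j else 0)"
        using bounded_degree_poly[of K j "?q i" "\<lambda>k. if k = j then M j else 0" u] K degq[OF i] by simp
      have 2: "(\<lambda>z. a i z * (?h i z * poly (?q i) (u j z))) \<in> bounded_degree K u M"
        by (rule bounded_degree_mult'[OF a[OF i] bounded_degree_mult[OF h q]]) (use dM in auto)
      show "(\<lambda>z. c * (a i z * (b i * u j z ^ (Suc (M j) - d))) - c * (a i z * (?h i z * poly (?q i) (u j z))))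
        \<in> bounded_degree K u M"
        using bounded_degree.add[OF smult[OF 1, of c] smult[OF 2, of "- c"]] by simp
    qed
    moreover have "c * (\<Prod>k\<in>K. u k z ^ e k) = g z" if z: "z \<in> Z" for z
    proof -
      have "c * (\<Prod>k\<in>K. u k z ^ e k) = c * (u j z ^ Suc (M j) * (\<Prod>k\<in>?S. u k z ^ e k))"
        using K ej by (simp add: prod.remove)
      also have "\<dots> = (\<Sum>i\<in>I. c * (a i z * (?h i z * u j z ^ Suc (M j))))"
        unfolding am by (simp add: sum_distrib_left mult_ac)
      also have "\<dots> = g z"
        unfolding g_def
      proof (rule sum.cong[OF refl])
        fix i assume i: "i \<in> I"
        have "u j z ^ Suc (M j) = u j z ^ (Suc (M j) - d) * u j z ^ d"
          using dM[OF K(2)] by (simp flip: power_add)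
        also have "\<dots> = u j z ^ (Suc (M j) - d) * poly (P i j) (u j z) - poly (?q i) (u j z)"
          by (simp add: low_def poly_monom algebra_simps)
        finally have 1: "u j z ^ Suc (M j) = u j z ^ (Suc (M j) - d) * poly (P i j) (u j z) - poly (?q i) (u j z)" .
        have 2: "b i = poly (P i j) (u j z) * ?h i z"
          using Z[OF i z] K by (simp add: prod.remove)
        show "c * (a i z * (?h i z * u j z ^ Suc (M j))) =
          c * (a i z * (b i * u j z ^ (Suc (M j) - d))) - c * (a i z * (?h i z * poly (?q i) (u j z)))"
          unfolding 1 2 by (simp only: algebra_simps)
      qed
      finally show ?thesis .
    qed
    ultimately show ?thesis by blast
  qed
qed

lemma sum_fun_apply: "(\<Sum>i\<in>A. f i) x = (\<Sum>i\<in>A. f i x)"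
  by (induction A rule: infinite_finite_induct) auto

text \<open>
  All functions on \<open>Z\<close> are polynomials in \<open>u j\<close>, hence are spanned by the monomials whose exponents are at
  most \<open>card I * d\<close>.
\<close>

theorem card_solutions_product_system:
  fixes P :: "'i \<Rightarrow> 'k \<Rightarrow> 'a::field_gcd poly" and u :: "'k \<Rightarrow> 'z \<Rightarrow> 'a"
  assumes K: "finite K" "j \<in> K" and I: "finite I" "card I = card K" and d: "d > 0"
    and deg: "\<And>i k. i \<in> I \<Longrightarrow> k \<in> K \<Longrightarrow> degree (P i k) = d"
    and monic: "\<And>i k. i \<in> I \<Longrightarrow> k \<in> K \<Longrightarrow> lead_coeff (P i k) = 1"
    and cop: "\<And>i i' k. i \<in> I \<Longrightarrow> i' \<in> I \<Longrightarrow> i \<noteq> i' \<Longrightarrow> k \<in> K \<Longrightarrow> coprime (P i k) (P i' k)"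
    and Z: "\<And>i z. i \<in> I \<Longrightarrow> z \<in> Z \<Longrightarrow> (\<Prod>k\<in>K. poly (P i k) (u k z)) = b i"
    and fin: "finite Z" and inj: "inj_on (u j) Z"
  shows "card Z \<le> (card I * d + 1) ^ card K"
proof -
  define m where "m = card I * d"
  \<comment> \<open>The degree in \<open>u j\<close> is lowered one unit at a time, from
    \<open>m + n\<close> down to \<open>m\<close>.\<close>
  have reduce: "\<exists>g\<in>bounded_degree K u (\<lambda>_. m). \<forall>z\<in>Z. f z = g z"
    if "f \<in> bounded_degree K u ((\<lambda>_. m)(j := m + n))" for f n
    using that
  proof (induction n arbitrary: f)
    case 0
    then have "f \<in> bounded_degree K u (\<lambda>_. m)" by (simp add: fun_upd_triv)
    then show ?case by blast
  next
    case (Suc n)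
    let ?M = "(\<lambda>_. m)(j := m + n)"
    have M: "?M(j := Suc (?M j)) = (\<lambda>_. m)(j := m + Suc n)" by simp
    have "f \<in> bounded_degree K u (?M(j := Suc (?M j)))" unfolding M by (rule Suc.prems)
    then have "\<exists>g\<in>bounded_degree K u ?M. \<forall>z\<in>Z. f z = g z"
      by (intro bounded_degree_reduce[OF K I d deg monic cop _ Z]) (auto simp: m_def)
    then show ?case using Suc.IH by (metis (no_types, lifting))
  qed
  interpret V: vector_space "\<lambda>(c::'a) (f::'z \<Rightarrow> 'a) z. c * f z"
    by unfold_locales (auto simp: algebra_simps fun_eq_iff)
  \<comment> \<open>Cutting off outside \<open>Z\<close> turns equality on \<open>Z\<close> into
    equality of vectors.\<close>
  define mon where "mon = (\<lambda>(e::'k \<Rightarrow> nat) z. if z \<in> Z then \<Prod>k\<in>K. u k z ^ e k else 0)"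
  define B where "B = mon ` (PiE K (\<lambda>_. {..m}))"
  have finB: "finite B" unfolding B_def using K(1) by (intro finite_imageI finite_PiE) auto
  have cardB: "card B \<le> (m + 1) ^ card K"
    unfolding B_def using card_image_le[of "PiE K (\<lambda>_. {..m})" mon] K(1)
    by (simp add: card_PiE finite_PiE)
  have span: "(\<lambda>z. if z \<in> Z then f z else 0) \<in> V.span B" if "f \<in> bounded_degree K u (\<lambda>_. m)" for f
    using that
  proof (induction rule: bounded_degree.induct)
    case (monomial e c)
    have "mon (restrict e K) \<in> B" unfolding B_def by (rule imageI) (use monomial in auto)
    then have "(\<lambda>z. c * mon (restrict e K) z) \<in> V.span B" by (intro V.span_scale V.span_base)
    moreover have "(\<lambda>z. c * mon (restrict e K) z) = (\<lambda>z. if z \<in> Z then c * (\<Prod>k\<in>K. u k z ^ e k) else 0)"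
      by (auto simp: mon_def fun_eq_iff)
    ultimately show ?case by simp
  next
    case (add f g)
    have "(\<lambda>z. if z \<in> Z then f z + g z else 0) = (\<lambda>z. if z \<in> Z then f z else 0) + (\<lambda>z. if z \<in> Z then g z else 0)"
      by (auto simp: fun_eq_iff)
    then show ?case using V.span_add[OF add.IH] by simp
  qed
  define \<delta> where "\<delta> = (\<lambda>(a::'z) z. if z = a then 1 else (0::'a))"
  have \<delta>_span: "\<delta> a \<in> V.span B" if a: "a \<in> Z" for a
  proof -
    \<comment> \<open>Lagrange interpolation at the nodes \<open>u j y\<close>, which are distinct
      by \<open>inj\<close>, writes the indicator of \<open>a\<close> as a polynomial in
      \<open>u j\<close>.\<close>
    define p where "p = smult (1 / (\<Prod>y\<in>Z - {a}. u j a - u j y)) (\<Prod>y\<in>Z - {a}. [:- u j y, 1:])"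
    have "poly p (u j z) = \<delta> a z" if "z \<in> Z" for z
    proof (cases "z = a")
      case True
      have "u j a - u j y \<noteq> 0" if "y \<in> Z - {a}" for y
        using inj a that by (auto dest: inj_onD)
      then have "(\<Prod>y\<in>Z - {a}. u j a - u j y) \<noteq> 0" using fin by simp
      with True show ?thesis by (simp add: p_def poly_prod \<delta>_def)
    next
      case False
      then have "(\<Prod>y\<in>Z - {a}. poly [:- u j y, 1:] (u j z)) = 0"
        using that fin by (intro prod_zero) (auto intro!: bexI[of _ z])
      then show ?thesis using False by (simp add: p_def poly_prod \<delta>_def)
    qed
    moreover have "(\<lambda>z. poly p (u j z)) \<in> bounded_degree K u ((\<lambda>_. m)(j := m + degree p))"
      by (rule bounded_degree_poly) (use K in auto)
    then obtain g where g: "g \<in> bounded_degree K u (\<lambda>_. m)" "\<forall>z\<in>Z. poly p (u j z) = g z"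
      using reduce by blast
    ultimately have "\<delta> a = (\<lambda>z. if z \<in> Z then g z else 0)"
      using a by (auto simp: fun_eq_iff \<delta>_def)
    then show ?thesis using span[OF g(1)] by simp
  qed
  have inj\<delta>: "inj_on \<delta> Z"
    by (rule inj_onI) (metis \<delta>_def zero_neq_one)
  have "V.independent (\<delta> ` Z)"
  proof
    assume "V.dependent (\<delta> ` Z)"
    then obtain c a where a: "a \<in> Z" "c (\<delta> a) \<noteq> 0" and 0: "(\<Sum>v\<in>\<delta> ` Z. (\<lambda>z. c v * v z)) = 0"
      using V.dependent_finite[of "\<delta> ` Z"] fin by auto
    have "(\<Sum>v\<in>\<delta> ` Z. (\<lambda>z. c v * v z)) a = (\<Sum>y\<in>Z. c (\<delta> y) * \<delta> y a)"
      using inj\<delta> by (simp add: sum_fun_apply sum.reindex)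
    also have "\<dots> = (\<Sum>y\<in>Z. if y = a then c (\<delta> y) else 0)"
      by (rule sum.cong) (auto simp: \<delta>_def)
    also have "\<dots> = c (\<delta> a)" using fin a by simp
    finally show False using 0 a by simp
  qed
  then have "card (\<delta> ` Z) \<le> card B"
    using V.independent_span_bound[OF finB] \<delta>_span by blast
  then show ?thesis using cardB card_image[OF inj\<delta>] by (simp add: m_def)
qed

section \<open>Norms over finite fields\<close>

lemma size_proots_alg_closed:
  fixes p :: "'a::alg_closed_field poly"
  shows "size (proots p) = degree p"
proof (cases "p = 0")
  case False
  then obtain A where A: "size A = degree p" "p = smult (lead_coeff p) (\<Prod>x\<in>#A. [:-x, 1:])"
    using alg_closed_imp_factorization by blast
  have "proots p = proots (\<Prod>x\<in>#A. [:-x, 1:])"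
    by (subst A(2)) (use False in simp)
  also have "\<dots> = A"
  proof (induction A)
    case (add x A)
    have "(\<Prod>x\<in>#A. [:- x, 1:]) \<noteq> 0" by (auto simp: prod_mset_zero_iff)
    then show ?case using add by (simp add: proots_mult del: mult_pCons_left)
  qed simp
  finally show ?thesis using A by simp
qed auto

text \<open>A multiple root would also be a root of the derivative. Hence the multiset of roots,
  whose size is the degree, has no repetitions.\<close>

lemma card_roots_separable:
  fixes p :: "'a::alg_closed_field poly"
  assumes "\<And>x. poly p x = 0 \<Longrightarrow> poly (pderiv p) x \<noteq> 0"
  shows "card {x. poly p x = 0} = degree p"
proof -
  have p0: "p \<noteq> 0" using assms by force
  have simple: "order x p = 1" if x: "poly p x = 0" for x
  proof (rule ccontr)
    assume "order x p \<noteq> 1"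
    moreover have "order x p \<noteq> 0" using x p0 by (simp add: order_root)
    ultimately have "[:- x, 1:] ^ 2 dvd p" by (simp add: order_divides p0)
    then obtain h where p: "p = [:- x, 1:] * [:- x, 1:] * h" unfolding power2_eq_square by (rule dvdE)
    have "poly (pderiv p) x = 0" unfolding p pderiv_mult poly_add poly_mult by simp
    then show False using assms x by blast
  qed
  have "proots p = mset_set {x. poly p x = 0}"
  proof (rule multiset_eqI)
    fix x show "count (proots p) x = count (mset_set {x. poly p x = 0}) x"
      using p0 poly_roots_finite[OF p0] simple[of x] by (cases "poly p x = 0") (auto simp: order_0I)
  qed
  then show ?thesis using size_proots_alg_closed[of p] by simp
qed

text \<open>
  All finite fields live inside one algebraically closed field: for a power \<open>N\<close> of the characteristic
  this is the subfield with \<open>N\<close> elements.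
\<close>

definition fixed_field :: "nat \<Rightarrow> 'a::monoid_mult set" where
  "fixed_field N = {x. x ^ N = x}"

text \<open>The elements are the roots of X^N - X, whose derivative is -1 because \<open>N\<close>
  vanishes in the field.\<close>

lemma card_fixed_field:
  assumes "prime CHAR('a::alg_closed_field)" "n > 0" "N = CHAR('a) ^ n"
  shows "card (fixed_field N :: 'a set) = N"
proof -
  have N: "N > 1" using assms one_less_power[OF prime_gt_1_nat[OF assms(1)]] by simp
  let ?p = "monom 1 N - monom 1 1 :: 'a poly"
  have deg: "degree ?p = N"
    using N degree_add_eq_left[of "- monom 1 1" "monom 1 N :: 'a poly"] by (simp add: degree_monom_eq)
  have "of_nat N = (0::'a)" using assms by (simp add: of_nat_eq_0_iff_char_dvd)
  then have "pderiv ?p = - 1" by (simp add: pderiv_diff pderiv_monom monom_0 one_pCons)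
  then have "card {x. poly ?p x = 0} = N" using card_roots_separable[of ?p] deg by simp
  then show ?thesis by (simp add: fixed_field_def poly_monom)
qed

lemma finite_fixed_field:
  assumes "prime CHAR('a::alg_closed_field)" "n > 0" "N = CHAR('a) ^ n"
  shows "finite (fixed_field N :: 'a set)"
  by (rule card_ge_0_finite) (use card_fixed_field[OF assms] assms prime_gt_0_nat[OF assms(1)] in simp)

section \<open>Frobenius maps and the arithmetic of the fixed fields\<close>

lemma frobenius_diff:
  fixes x y :: "'a::comm_ring_1"
  assumes "prime CHAR('a)" "N = CHAR('a) ^ n"
  shows "(x - y) ^ N = x ^ N - y ^ N"
  using freshmans_dream'[OF assms, of "x - y" y] by (simp add: algebra_simps)

lemma frobenius_inj:
  fixes x y :: "'a::field"
  assumes "prime CHAR('a)" "N = CHAR('a) ^ n" "x ^ N = y ^ N"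
  shows "x = y"
  using frobenius_diff[OF assms(1,2), of x y] assms(3) by simp

lemma fixed_field_add:
  assumes "prime CHAR('a::comm_ring_1)" "N = CHAR('a) ^ n" "x \<in> fixed_field N" "y \<in> fixed_field N"
  shows "x + y \<in> (fixed_field N :: 'a set)"
  using assms freshmans_dream'[OF assms(1,2), of x y] by (simp add: fixed_field_def)

lemma fixed_field_diff:
  assumes "prime CHAR('a::comm_ring_1)" "N = CHAR('a) ^ n" "x \<in> fixed_field N" "y \<in> fixed_field N"
  shows "x - y \<in> (fixed_field N :: 'a set)"
  using assms frobenius_diff[OF assms(1,2), of x y] by (simp add: fixed_field_def)

lemma fixed_field_0 [simp]: "N > 0 \<Longrightarrow> (0 :: 'a::semiring_1) \<in> fixed_field N"
  by (simp add: fixed_field_def power_0_left)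

lemma fixed_field_1 [simp]: "1 \<in> fixed_field N"
  by (simp add: fixed_field_def)

lemma fixed_field_mult:
  "x \<in> fixed_field N \<Longrightarrow> y \<in> fixed_field N \<Longrightarrow> (x * y :: 'a::comm_monoid_mult) \<in> fixed_field N"
  by (simp add: fixed_field_def power_mult_distrib)

lemma fixed_field_divide:
  "x \<in> fixed_field N \<Longrightarrow> y \<in> fixed_field N \<Longrightarrow> (x / y :: 'a::field) \<in> fixed_field N"
  by (simp add: fixed_field_def power_divide)

lemma fixed_field_sum:
  assumes "prime CHAR('a::comm_ring_1)" "N = CHAR('a) ^ n" "\<And>i. i \<in> A \<Longrightarrow> f i \<in> fixed_field N"
  shows "sum f A \<in> (fixed_field N :: 'a set)"
  using assms(3)
proof (induction A rule: infinite_finite_induct)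
  case (insert x A)
  then show ?case using fixed_field_add[OF assms(1,2), of "f x" "sum f A"] by simp
qed (use assms(1,2) prime_gt_0_nat[OF assms(1)] in auto)

lemma fixed_field_power_power:
  "x \<in> fixed_field N \<Longrightarrow> x ^ (N ^ m) = x"
  by (induction m) (auto simp: fixed_field_def power_mult)

lemma fixed_field_subset: "fixed_field N \<subseteq> fixed_field (N ^ m)"
  using fixed_field_power_power by (auto simp: fixed_field_def)

text \<open>Greedy choice by counting: the combinations of the first \<open>r\<close> elements
  number at most \<open>card K ^ r\<close>, fewer than \<open>card L\<close> when one more element
  is wanted, so some \<open>a\<close> lies outside. Linear independence over \<open>K\<close> is
  phrased as injectivity of the combination map.\<close>

lemma exists_independent_elements:
  fixes K L :: "'a::field set"
  assumes "finite K" "card L \<ge> card K ^ r" "card K \<ge> 2"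
    and K: "\<And>x y. x \<in> K \<Longrightarrow> y \<in> K \<Longrightarrow> x - y \<in> K" "\<And>x y. x \<in> K \<Longrightarrow> y \<in> K \<Longrightarrow> x / y \<in> K"
  shows "\<exists>\<theta>. (\<forall>i<r. \<theta> i \<in> L) \<and> inj_on (\<lambda>x. \<Sum>i<r. \<theta> i * x i) (PiE {..<r} (\<lambda>_. K))"
  using assms(2)
proof (induction r)
  case 0
  then show ?case by (intro exI[of _ undefined]) auto
next
  case (Suc r)
  have lt: "card K ^ r < card L"
    by (rule less_le_trans[OF _ Suc.prems]) (use \<open>card K \<ge> 2\<close> in simp)
  then obtain \<theta> where \<theta>: "\<forall>i<r. \<theta> i \<in> L" and inj: "inj_on (\<lambda>x. \<Sum>i<r. \<theta> i * x i) (PiE {..<r} (\<lambda>_. K))"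
    using Suc.IH[OF less_imp_le] by blast
  define V where "V = (\<lambda>x. \<Sum>i<r. \<theta> i * x i) ` (PiE {..<r} (\<lambda>_. K))"
  have "finite V" unfolding V_def using \<open>finite K\<close> by (intro finite_imageI finite_PiE) auto
  have "card V \<le> card K ^ r"
    unfolding V_def using card_image_le[of "PiE {..<r} (\<lambda>_. K)" "\<lambda>x. \<Sum>i<r. \<theta> i * x i"] \<open>finite K\<close>
    by (simp add: card_PiE finite_PiE)
  then have "\<not> L \<subseteq> V" using lt \<open>finite V\<close> card_mono by (metis leD le_trans)
  then obtain a where a: "a \<in> L" "a \<notin> V" by blast
  let ?\<theta> = "\<theta>(r := a)"
  have "inj_on (\<lambda>x. \<Sum>i<Suc r. ?\<theta> i * x i) (PiE {..<Suc r} (\<lambda>_. K))"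
  proof (rule inj_onI)
    fix x y assume x: "x \<in> PiE {..<Suc r} (\<lambda>_. K)" and y: "y \<in> PiE {..<Suc r} (\<lambda>_. K)"
      and eq: "(\<Sum>i<Suc r. ?\<theta> i * x i) = (\<Sum>i<Suc r. ?\<theta> i * y i)"
    have xK: "x i \<in> K" "y i \<in> K" if "i < Suc r" for i using x y that by auto
    have eq': "(\<Sum>i<r. \<theta> i * x i) + a * x r = (\<Sum>i<r. \<theta> i * y i) + a * y r"
      using eq by simp
    have "x r = y r"
    proof (rule ccontr)
      assume ne: "x r \<noteq> y r"
      \<comment> \<open>If the last coefficients differed, solving for \<open>a\<close> would put it
        into \<open>V\<close>.\<close>
      have "a * (x r - y r) = (\<Sum>i<r. \<theta> i * (y i - x i))"
        using eq' by (simp add: algebra_simps sum_subtractf)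
      then have "a = (\<Sum>i<r. \<theta> i * (y i - x i)) / (x r - y r)" using ne by (simp add: field_simps)
      also have "\<dots> = (\<Sum>i<r. \<theta> i * restrict (\<lambda>i. (y i - x i) / (x r - y r)) {..<r} i)"
        by (simp add: sum_divide_distrib)
      also have "\<dots> \<in> V" unfolding V_def by (rule imageI, simp only: restrict_PiE_iff) (use xK K in auto)
      finally show False using a by simp
    qed
    with eq' have "(\<Sum>i<r. \<theta> i * restrict x {..<r} i) = (\<Sum>i<r. \<theta> i * restrict y {..<r} i)" by simp
    then have "restrict x {..<r} = restrict y {..<r}"
      by (rule inj_onD[OF inj], simp_all only: restrict_PiE_iff) (use xK in auto)
    then have "x i = y i" if "i < Suc r" for i
      using that \<open>x r = y r\<close> by (metis lessThan_iff less_Suc_eq restrict_apply')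
    then show "x = y" by (intro PiE_ext[OF x y]) auto
  qed
  then show ?case using \<theta> a by (intro exI[of _ ?\<theta>]) auto
qed

text \<open>The orbit under the Frobenius map with exponent \<open>Q\<close>. For a positive power
  \<open>Q\<close> of a prime characteristic and \<open>x\<close> in
  \<open>fixed_field (Q ^ r)\<close>, these are the conjugates of \<open>x\<close> over
  \<open>fixed_field Q\<close>.\<close>

definition conjugates :: "nat \<Rightarrow> 'a::monoid_mult \<Rightarrow> 'a set" where
  "conjugates Q x = range (\<lambda>m. x ^ (Q ^ m))"

text \<open>A colouring that separates conjugates; on \<open>fixed_field (Q ^ r)\<close> it uses \<open>r\<close> colours.\<close>

definition conjugate_index :: "nat \<Rightarrow> 'a::monoid_mult \<Rightarrow> nat" where
  "conjugate_index Q x = (LEAST m. x = (SOME z. z \<in> conjugates Q x) ^ (Q ^ m))"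

text \<open>Only nonnegative iterates occur in the orbit, but \<open>r\<close> of them lead back to
  \<open>x\<close>. So the way from \<open>x\<close> to \<open>y\<close> is undone by completing
  \<open>n\<close> full rounds.\<close>

lemma conjugates_eq:
  assumes "y \<in> conjugates Q x" "x \<in> fixed_field (Q ^ r)" "r > 0"
  shows "conjugates Q y = conjugates Q x"
proof -
  obtain n where y: "y = x ^ (Q ^ n)" using assms(1) by (auto simp: conjugates_def)
  have pp: "y ^ (Q ^ m) = x ^ (Q ^ (n + m))" for m
    by (simp add: y power_add flip: power_mult)
  have "x = y ^ (Q ^ (n * r - n))"
  proof -
    have "n \<le> n * r" using assms(3) by simp
    then have "y ^ (Q ^ (n * r - n)) = x ^ ((Q ^ r) ^ n)"
      by (simp add: pp mult.commute flip: power_mult)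
    then show ?thesis using fixed_field_power_power[OF assms(2)] by simp
  qed
  then have "x ^ (Q ^ m) = y ^ (Q ^ ((n * r - n) + m))" for m
    by (metis power_add power_mult)
  with pp show ?thesis unfolding conjugates_def image_def by blast
qed

text \<open>The representative \<open>z\<close> is a member of the orbit and therefore reaches
  \<open>x\<close> by iteration; the exponent can be reduced modulo \<open>r\<close> because the
  \<open>r\<close>-th iterate fixes \<open>z\<close>.\<close>

lemma conjugate_index_properties:
  assumes "x \<in> fixed_field (Q ^ r)" "r > 0" "Q > 0"
  shows conjugate_index_eq: "x = (SOME z. z \<in> conjugates Q x) ^ (Q ^ conjugate_index Q x)"
    and conjugate_index_less: "conjugate_index Q x < r"
proof -
  define z where "z = (SOME z. z \<in> conjugates Q x)"
  have "x \<in> conjugates Q x" unfolding conjugates_def by (rule range_eqI[of _ _ 0]) simp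
  then have z: "z \<in> conjugates Q x" unfolding z_def by (rule someI)
  then obtain n where n: "z = x ^ (Q ^ n)" by (auto simp: conjugates_def)
  have zr: "z ^ (Q ^ r) = z"
  proof -
    have "z ^ (Q ^ r) = (x ^ (Q ^ r)) ^ (Q ^ n)" unfolding n by (metis mult.commute power_mult)
    then show ?thesis using assms(1) by (simp add: n fixed_field_def)
  qed
  have "x \<in> conjugates Q z"
    using conjugates_eq[OF z assms(1,2)] \<open>x \<in> conjugates Q x\<close> by simp
  then obtain m where m: "x = z ^ (Q ^ m)" by (auto simp: conjugates_def)
  have "x = z ^ (Q ^ (m mod r))"
  proof -
    have "m = r * (m div r) + m mod r" by simp
    then have "z ^ (Q ^ m) = (z ^ ((Q ^ r) ^ (m div r))) ^ (Q ^ (m mod r))"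
      by (metis power_add power_mult)
    also have "z ^ ((Q ^ r) ^ (m div r)) = z"
      using zr by (intro fixed_field_power_power) (simp add: fixed_field_def)
    finally show ?thesis using m by simp
  qed
  then show "x = (SOME z. z \<in> conjugates Q x) ^ (Q ^ conjugate_index Q x)"
    and "conjugate_index Q x < r"
    unfolding conjugate_index_def z_def[symmetric]
    using assms(2) LeastI[of "\<lambda>m. x = z ^ (Q ^ m)"] Least_le[of "\<lambda>m. x = z ^ (Q ^ m)" "m mod r"]
      mod_less_divisor[of r m] by (auto intro: le_less_trans)
qed

lemma conjugate_index_inj:
  assumes "x \<in> fixed_field (Q ^ r)" "y \<in> fixed_field (Q ^ r)" "r > 0" "Q > 0"
    and "y \<in> conjugates Q x" "conjugate_index Q x = conjugate_index Q y"
  shows "x = y"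
proof -
  have "x = (SOME z. z \<in> conjugates Q x) ^ (Q ^ conjugate_index Q x)"
    by (rule conjugate_index_eq[OF assms(1,3,4)])
  also have "\<dots> = (SOME z. z \<in> conjugates Q y) ^ (Q ^ conjugate_index Q y)"
    by (simp only: conjugates_eq[OF assms(5,1,3)] assms(6))
  also have "\<dots> = y" by (rule conjugate_index_eq[OF assms(2,3,4), symmetric])
  finally show ?thesis .
qed

text \<open>For \<open>q\<close> a positive power of a prime characteristic, this is on
  \<open>fixed_field (q ^ n)\<close> the norm to \<open>fixed_field q\<close>.\<close>

definition field_norm :: "nat \<Rightarrow> nat \<Rightarrow> 'a::comm_monoid_mult \<Rightarrow> 'a" where
  "field_norm q n z = (\<Prod>k<n. z ^ (q ^ k))"

lemma field_norm_mult: "field_norm q n (x * y) = field_norm q n x * field_norm q n y"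
  by (simp add: field_norm_def power_mult_distrib prod.distrib)

text \<open>The exponents form a geometric series, which times \<open>q - 1\<close> is
  \<open>q ^ n - 1\<close>. For \<open>q > 1\<close> the norms of nonzero elements thus take at most
  \<open>q - 1\<close> values, the count that enters the pigeonhole argument.\<close>

lemma field_norm_power_root_of_unity:
  fixes z :: "'a::field"
  assumes "z \<in> fixed_field (q ^ n)" "z \<noteq> 0" "q > 0"
  shows "field_norm q n z ^ (q - 1) = 1"
proof -
  have "field_norm q n z = z ^ (\<Sum>k<n. q ^ k)"
    by (simp add: field_norm_def power_sum)
  then have "field_norm q n z ^ (q - 1) = z ^ ((\<Sum>k<n. q ^ k) * (q - 1))"
    by (simp add: power_mult)
  also have "(\<Sum>k<n. q ^ k) * (q - 1) = q ^ n - 1"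
    using power_diff_1_eq[of "int q" n] assms(3)
    by (simp add: mult.commute flip: of_nat_eq_iff[where 'a=int])
  also have "z ^ (q ^ n - 1) = 1"
  proof -
    have "z * z ^ (q ^ n - 1) = z ^ (q ^ n)" using assms(3) by (simp flip: power_Suc)
    then show ?thesis using assms by (simp add: fixed_field_def)
  qed
  finally show ?thesis .
qed

lemma card_roots_of_unity_le:
  fixes m :: nat
  assumes "m > 0"
  shows "finite {c::'a::idom. c ^ m = 1}" "card {c::'a::idom. c ^ m = 1} \<le> m"
proof -
  let ?p = "monom 1 m - 1 :: 'a poly"
  have "degree ?p = m" using assms degree_add_eq_left[of "- 1" "monom 1 m :: 'a poly"] by (simp add: degree_monom_eq)
  then have "?p \<noteq> 0" using assms by auto
  moreover have "{c::'a. c ^ m = 1} = {c. poly ?p c = 0}" by (simp add: poly_monom)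
  ultimately show "finite {c::'a::idom. c ^ m = 1}" "card {c::'a::idom. c ^ m = 1} \<le> m"
    using poly_roots_finite[of ?p] card_poly_roots_bound[of ?p] \<open>degree ?p = m\<close> by auto
qed

lemma coprime_linear_polys:
  fixes a b :: "'a::field_gcd"
  assumes "a \<noteq> b"
  shows "coprime [:- a, 1:] [:- b, 1:]"
proof (rule coprimeI)
  fix c assume "c dvd [:- a, 1:]" "c dvd [:- b, 1:]"
  then have "c dvd [:- a, 1:] - [:- b, 1:]" by (rule dvd_diff)
  also have "[:- a, 1:] - [:- b, 1:] = [:b - a:]" by simp
  also have "[:b - a:] dvd 1" using assms by (simp add: is_unit_const_poly_iff dvd_field_iff)
  finally show "is_unit c" .
qed

text \<open>Write an index below \<open>t * r\<close> as \<open>m * t + k\<close>. As the power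
  \<open>q ^ t\<close> fixes \<open>y\<close>, the conjugate of \<open>y\<close> depends on
  \<open>k\<close> alone. So the norm equation becomes a product over the \<open>t\<close>
  coordinates \<open>y ^ (q ^ k)\<close> of polynomials of degree \<open>r\<close>, and the
  \<open>t\<close> elements of \<open>A\<close> give \<open>t\<close> equations.\<close>

lemma card_norm_fibre:
  fixes A Z :: "'a::{alg_closed_field, field_gcd} set"
  assumes char: "prime CHAR('a)" and q: "q = CHAR('a) ^ n" "n > 0"
    and t: "t > 0" and r: "r > 0"
    and A: "A \<subseteq> fixed_field (q ^ (t * r))" "finite A" "card A = t"
    and nonconj: "\<And>x y. x \<in> A \<Longrightarrow> y \<in> A \<Longrightarrow> y \<in> conjugates (q ^ t) x \<Longrightarrow> x = y"
    and Z: "Z \<subseteq> fixed_field (q ^ t)"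
    and norm: "\<And>x y. x \<in> A \<Longrightarrow> y \<in> Z \<Longrightarrow> field_norm q (t * r) (y - x) = b"
  shows "card Z \<le> (t * r + 1) ^ t"
proof -
  define P where "P = (\<lambda>x k. \<Prod>m<r. [:- (x ^ (q ^ (m * t + k))), 1:] :: 'a poly)"
  have qpow: "q ^ m = CHAR('a) ^ (n * m)" for m by (simp add: q power_mult)
  have finZ: "finite Z"
    by (rule finite_subset[OF Z finite_fixed_field[OF char _ qpow]]) (use q t in simp)
  have "card Z \<le> (card A * r + 1) ^ card {..<t}"
  \<comment> \<open>Coordinate \<open>0\<close> is \<open>y\<close> itself and thus separates the
    elements of \<open>Z\<close>.\<close>
  proof (rule card_solutions_product_system[where P = P and u = "\<lambda>k y. y ^ (q ^ k)" and j = 0 and b = "\<lambda>_. b"])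
    show "degree (P x k) = r" for x k
      unfolding P_def by (subst degree_prod_eq_sum_degree) auto
    show "lead_coeff (P x k) = 1" for x k
      unfolding P_def by (simp add: lead_coeff_prod)
    show "coprime (P x k) (P y k)" if "x \<in> A" "y \<in> A" "x \<noteq> y" for x y k
      unfolding P_def
    proof (intro prod_coprime_left prod_coprime_right coprime_linear_polys notI)
      \<comment> \<open>A common root would, once the Frobenius power \<open>q ^ k\<close> is
        cancelled, be a common conjugate of \<open>x\<close> and \<open>y\<close>.\<close>
      fix m m' assume "m \<in> {..<r}" "m' \<in> {..<r}" and eq: "x ^ (q ^ (m * t + k)) = y ^ (q ^ (m' * t + k))"
      have *: "z ^ (q ^ (i * t + k)) = (z ^ ((q ^ t) ^ i)) ^ (q ^ k)" for z :: 'a and i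
        by (simp add: power_add mult.commute flip: power_mult)
      have "x ^ ((q ^ t) ^ m) = y ^ ((q ^ t) ^ m')"
        by (rule frobenius_inj[OF char qpow[of k]]) (use eq in \<open>simp only: *\<close>)
      then have "x ^ ((q ^ t) ^ m) \<in> conjugates (q ^ t) y" "x ^ ((q ^ t) ^ m) \<in> conjugates (q ^ t) x"
        unfolding conjugates_def by blast+
      moreover have "x \<in> fixed_field ((q ^ t) ^ r)" "y \<in> fixed_field ((q ^ t) ^ r)"
        using A(1) that by (auto simp: power_mult)
      ultimately have "conjugates (q ^ t) x = conjugates (q ^ t) y"
        using conjugates_eq r by metis
      moreover have "y \<in> conjugates (q ^ t) y"
        unfolding conjugates_def by (rule range_eqI[of _ _ 0]) simp
      ultimately show False using nonconj[of x y] that by simp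
    qed
    show "(\<Prod>k<t. poly (P x k) (y ^ (q ^ k))) = b" if "x \<in> A" "y \<in> Z" for x y
    proof -
      have y: "y ^ (q ^ (m * t + k)) = y ^ (q ^ k)" for m k
      proof -
        have "y ^ ((q ^ t) ^ m) = y" using Z that by (intro fixed_field_power_power) auto
        then have "(y ^ ((q ^ t) ^ m)) ^ (q ^ k) = y ^ (q ^ k)" by simp
        then show ?thesis by (simp add: power_add mult.commute flip: power_mult)
      qed
      have "b = (\<Prod>l<r * t. (y - x) ^ (q ^ l))"
        using norm[OF that] by (simp add: field_norm_def mult.commute)
      also have "\<dots> = (\<Prod>m<r. \<Prod>l=m * t..<m * t + t. (y - x) ^ (q ^ l))"
        by (rule prod.nat_group[symmetric])
      also have "\<dots> = (\<Prod>m<r. \<Prod>k<t. (y - x) ^ (q ^ (m * t + k)))"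
      proof (rule prod.cong[OF refl])
        fix m
        show "(\<Prod>l=m * t..<m * t + t. (y - x) ^ (q ^ l)) = (\<Prod>k<t. (y - x) ^ (q ^ (m * t + k)))"
          by (rule prod.reindex_bij_witness[of _ "\<lambda>k. m * t + k" "\<lambda>l. l - m * t"]) auto
      qed
      also have "\<dots> = (\<Prod>k<t. \<Prod>m<r. (y - x) ^ (q ^ (m * t + k)))" by (rule prod.swap)
      also have "\<dots> = (\<Prod>k<t. poly (P x k) (y ^ (q ^ k)))"
        unfolding P_def by (simp add: poly_prod frobenius_diff[OF char qpow] y)
      finally show ?thesis by simp
    qed
    show "inj_on (\<lambda>y. y ^ (q ^ 0)) Z" by simp
  qed (use A t r finZ in auto)
  then show ?thesis using A by simp
qed

text \<open>
  In the last conclusion \<open>W\<close> is the set of \<open>(r-1)\<close>-tuples, the value of \<open>w \<in> W\<close> at \<open>j\<close> being irrelevant.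
  The tuples need only be distinct, not disjoint.
\<close>

lemma norm_hypergraph_tuples:
  fixes r t n :: nat
  assumes char: "prime CHAR('a::{alg_closed_field, field_gcd})" and q: "q = CHAR('a) ^ n" "n > 0"
    and t: "t > 0" and r: "r > 0"
  shows "\<exists>E :: (nat \<Rightarrow> 'a) set. E \<subseteq> PiE {..<r} (\<lambda>_. fixed_field (q ^ t)) \<and>
    q ^ (t * r) - 1 \<le> card E * ((q - 1) * r ^ r) \<and>
    (\<forall>j<r. \<forall>W Y. finite W \<longrightarrow> card W = t \<longrightarrow> (\<forall>w\<in>W. \<forall>y\<in>Y. w(j := y) \<in> E) \<longrightarrow>
      (\<forall>w\<in>W. \<forall>w'\<in>W. w \<noteq> w' \<longrightarrow> (\<exists>i<r. i \<noteq> j \<and> w i \<noteq> w' i)) \<longrightarrow> card Y \<le> (t * r + 1) ^ t)"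
proof -
  define Q where "Q = q ^ t"
  define K L :: "'a set" where "K = fixed_field Q" and "L = fixed_field (Q ^ r)"
  have qpow: "q ^ m = CHAR('a) ^ (n * m)" for m by (simp add: q power_mult)
  have Qpow: "Q ^ m = CHAR('a) ^ (n * t * m)" for m by (simp add: Q_def q flip: power_mult)
  have p2: "CHAR('a) \<ge> 2" using char by (rule prime_ge_2_nat)
  have q2: "q \<ge> 2" using q p2 by (metis self_le_power le_trans one_le_numeral)
  have Q2: "Q \<ge> 2" unfolding Q_def using q2 t by (metis self_le_power le_trans one_le_numeral Suc_leI One_nat_def)
  have cK: "card K = Q" unfolding K_def
    by (rule card_fixed_field[OF char, of "n * t"]) (use q t Qpow[of 1] in auto)
  have fK: "finite K" using cK Q2 card_ge_0_finite[of K] by simp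
  have cL: "card L = Q ^ r" unfolding L_def
    by (rule card_fixed_field[OF char _ Qpow]) (use q t r in auto)
  have KL: "K \<subseteq> L" unfolding K_def L_def by (rule fixed_field_subset)
  have K0: "0 \<in> K" "1 \<in> K" unfolding K_def using Q2 by auto
  have "\<exists>\<theta>. (\<forall>i<r. \<theta> i \<in> L) \<and> inj_on (\<lambda>x. \<Sum>i<r. \<theta> i * x i) (PiE {..<r} (\<lambda>_. K))"
    by (rule exists_independent_elements[OF fK])
      (use cK cL Q2 Qpow[of 1] in \<open>auto simp: K_def intro: fixed_field_diff[OF char] fixed_field_divide\<close>)
  then obtain \<theta> where \<theta>L: "\<And>i. i < r \<Longrightarrow> \<theta> i \<in> L"
    and inj: "inj_on (\<lambda>x. \<Sum>i<r. \<theta> i * x i) (PiE {..<r} (\<lambda>_. K))" by blast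
  define s where "s = (\<lambda>x. \<Sum>i<r. \<theta> i * x i)"
  have inj: "inj_on s (PiE {..<r} (\<lambda>_. K))" using inj by (simp add: s_def)
  define z where "z = restrict (\<lambda>_. 0 :: 'a) {..<r}"
  have zP: "z \<in> PiE {..<r} (\<lambda>_. K)" unfolding z_def restrict_PiE_iff using K0 by simp
  have sz: "s z = 0" by (simp add: s_def z_def)
  have \<theta>0: "\<theta> j \<noteq> 0" if "j < r" for j
  proof
    assume 0: "\<theta> j = 0"
    have "s (z(j := 1)) = s z"
      unfolding sz unfolding s_def by (rule sum.neutral) (use 0 in \<open>auto simp: z_def\<close>)
    moreover have "z(j := 1) \<in> PiE {..<r} (\<lambda>_. K)"
      using zP K0 that by (auto simp: PiE_iff extensional_def)
    ultimately have "z(j := 1) = z" by (intro inj_onD[OF inj _ _ zP])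
    then have "(z(j := 1)) j = z j" by simp
    then show False using that by (simp add: z_def)
  qed
  \<comment> \<open>Only the zero tuple has norm \<open>0\<close>; without it all norms are roots of
    unity.\<close>
  define T where "T = PiE {..<r} (\<lambda>_. K) - {z}"
  have fP: "finite (PiE {..<r} (\<lambda>_. K))" using fK by (intro finite_PiE) auto
  have cT: "card T = q ^ (t * r) - 1"
    unfolding T_def using zP fP by (simp add: card_PiE cK Q_def power_mult)
  \<comment> \<open>Solving \<open>s x = 0\<close> for the \<open>j\<close>-th coordinate gives
    \<open>\<alpha> j x\<close>, which depends on the other coordinates only.\<close>
  define \<alpha> where "\<alpha> = (\<lambda>j x. - (\<Sum>i\<in>{..<r} - {j}. \<theta> i * x i) / \<theta> j)"
  have s_eq: "s x = \<theta> j * (x j - \<alpha> j x)" if "j < r" for j and x :: "nat \<Rightarrow> 'a"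
  proof -
    have "s x = \<theta> j * x j + (\<Sum>i\<in>{..<r} - {j}. \<theta> i * x i)"
      unfolding s_def using that by (subst sum.remove[of _ j]) auto
    then show ?thesis using \<theta>0[OF that] by (simp add: \<alpha>_def algebra_simps)
  qed
  have \<alpha>_upd: "\<alpha> j (x(j := y)) = \<alpha> j x" for j x y
    unfolding \<alpha>_def by (intro arg_cong2[of _ _ _ _ "(/)"] arg_cong[of _ _ uminus] sum.cong) auto
  have \<theta>xL: "(\<Sum>i\<in>I. \<theta> i * x i) \<in> L" if "x \<in> PiE {..<r} (\<lambda>_. K)" "I \<subseteq> {..<r}" for x I
    unfolding L_def
  proof (rule fixed_field_sum[OF char Qpow])
    fix i assume "i \<in> I"
    then have "\<theta> i \<in> L" "x i \<in> L" using that \<theta>L KL by auto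
    then show "\<theta> i * x i \<in> fixed_field (Q ^ r)" by (simp add: L_def fixed_field_mult)
  qed
  have sL: "s x \<in> L" if "x \<in> PiE {..<r} (\<lambda>_. K)" for x
    unfolding s_def by (rule \<theta>xL[OF that]) simp
  have \<alpha>L: "\<alpha> j x \<in> L" if "j < r" "x \<in> PiE {..<r} (\<lambda>_. K)" for j x
  proof -
    have "0 - (\<Sum>i\<in>{..<r} - {j}. \<theta> i * x i) \<in> L"
      unfolding L_def by (rule fixed_field_diff[OF char Qpow])
        (use \<theta>xL[OF that(2), of "{..<r} - {j}"] Q2 in \<open>auto simp: L_def\<close>)
    then have "(0 - (\<Sum>i\<in>{..<r} - {j}. \<theta> i * x i)) / \<theta> j \<in> L"
      using \<theta>L[OF that(1)] unfolding L_def by (rule fixed_field_divide)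
    then show ?thesis by (simp add: \<alpha>_def)
  qed
  have s0: "s x \<noteq> 0" if "x \<in> T" for x
    using that inj_onD[OF inj _ _ zP] sz by (auto simp: T_def)
  \<comment> \<open>\<open>f\<close> records the norm and, for every \<open>j\<close>, the colour of
    \<open>\<alpha> j x\<close>. A large fibre of \<open>f\<close> fixes all of these at
    once.\<close>
  define f where "f = (\<lambda>x. (field_norm q (t * r) (s x), restrict (\<lambda>j. conjugate_index Q (\<alpha> j x)) {..<r}))"
  define B where "B = {c::'a. c ^ (q - 1) = 1} \<times> PiE {..<r} (\<lambda>_. {..<r})"
  have "f \<in> T \<rightarrow> B"
  proof
    fix x assume x: "x \<in> T"
    then have xP: "x \<in> PiE {..<r} (\<lambda>_. K)" by (simp add: T_def)
    have "field_norm q (t * r) (s x) ^ (q - 1) = 1"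
      by (rule field_norm_power_root_of_unity[OF _ s0[OF x]])
        (use sL[OF xP] q2 in \<open>auto simp: L_def Q_def power_mult\<close>)
    moreover have "restrict (\<lambda>j. conjugate_index Q (\<alpha> j x)) {..<r} \<in> PiE {..<r} (\<lambda>_. {..<r})"
      unfolding restrict_PiE_iff
    proof
      fix j assume "j \<in> {..<r}"
      then show "conjugate_index Q (\<alpha> j x) \<in> {..<r}"
        using conjugate_index_less[of "\<alpha> j x" Q r] \<alpha>L[OF _ xP] r Q2 by (simp add: L_def)
    qed
    ultimately show "f x \<in> B" by (simp add: f_def B_def)
  qed
  moreover have "finite T" unfolding T_def using fP by simp
  moreover have rou: "finite {c::'a. c ^ (q - 1) = 1}" "card {c::'a. c ^ (q - 1) = 1} \<le> q - 1"
    using card_roots_of_unity_le[of "q - 1"] q2 by auto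
  then have "finite B" unfolding B_def by (intro finite_cartesian_product finite_PiE) auto
  moreover have "(1, restrict (\<lambda>_. 0) {..<r}) \<in> B"
    unfolding B_def using r by (simp add: restrict_PiE_iff del: restrict_apply)
  then have "B \<noteq> {}" by blast
  ultimately obtain y where y: "y \<in> B" "card (f -` {y} \<inter> T) * card B \<ge> card T"
    using pigeonhole_card[of f T B] by blast
  define E where "E = f -` {y} \<inter> T"
  have cB: "card B \<le> (q - 1) * r ^ r"
    unfolding B_def using rou by (simp add: card_cartesian_product card_PiE)
  have EP: "E \<subseteq> PiE {..<r} (\<lambda>_. K)" by (auto simp: E_def T_def)
  have fE: "f x = y" if "x \<in> E" for x using that by (simp add: E_def)
  show ?thesis
  proof (intro exI[of _ E] conjI allI impI)
    show "E \<subseteq> PiE {..<r} (\<lambda>_. fixed_field (q ^ t))" using EP by (simp add: K_def Q_def)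
    have "q ^ (t * r) - 1 \<le> card E * card B" using y(2) by (simp add: cT E_def)
    also have "\<dots> \<le> card E * ((q - 1) * r ^ r)" using cB by (rule mult_le_mono2)
    finally show "q ^ (t * r) - 1 \<le> card E * ((q - 1) * r ^ r)" .
  next
    fix j W Y
    assume j: "j < r" and W: "finite W" "card W = t" and WY: "\<forall>w\<in>W. \<forall>y\<in>Y. w(j := y) \<in> E"
      and diff: "\<forall>w\<in>W. \<forall>w'\<in>W. w \<noteq> w' \<longrightarrow> (\<exists>i<r. i \<noteq> j \<and> w i \<noteq> w' i)"
    show "card Y \<le> (t * r + 1) ^ t"
    proof (cases "Y = {}")
      case False
      then obtain y0 where y0: "y0 \<in> Y" by blast
      have "W \<noteq> {}" using W t by auto
      \<comment> \<open>With the same entry \<open>y0\<close> at \<open>j\<close>, equal values of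
        \<open>\<alpha>\<close> give equal values of \<open>s\<close>, which is injective. This is
        why \<open>Y\<close> must be nonempty here.\<close>
      have eq: "w = w'" if "w \<in> W" "w' \<in> W" "\<alpha> j w = \<alpha> j w'" for w w'
      proof -
        have "s (w(j := y0)) = s (w'(j := y0))" by (simp add: s_eq[OF j] \<alpha>_upd that)
        then have "w(j := y0) = w'(j := y0)"
          by (rule inj_onD[OF inj]) (use WY EP y0 that in blast)+
        then have "w i = w' i" if "i \<noteq> j" for i using that by (metis fun_upd_other)
        then show ?thesis using diff that by blast
      qed
      have wL: "\<alpha> j w \<in> L" if "w \<in> W" for w
      proof -
        have "w(j := y0) \<in> PiE {..<r} (\<lambda>_. K)" using WY y0 EP that by blast
        from \<alpha>L[OF j this] show ?thesis by (simp add: \<alpha>_upd)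
      qed
      \<comment> \<open>By multiplicativity the norm of \<open>\<theta> j\<close> moves to the
        right-hand side.\<close>
      define b where "b = fst y / field_norm q (t * r) (\<theta> j)"
      have "card Y \<le> (t * r + 1) ^ t"
      proof (rule card_norm_fibre[OF char q t r, of "\<alpha> j ` W" Y b])
        show "\<alpha> j ` W \<subseteq> fixed_field (q ^ (t * r))"
          using wL by (auto simp: L_def Q_def power_mult)
        show "finite (\<alpha> j ` W)" using W by simp
        show "card (\<alpha> j ` W) = t" using W eq by (subst card_image) (auto intro: inj_onI)
        show "Y \<subseteq> fixed_field (q ^ t)"
        proof
          fix v assume "v \<in> Y"
          with \<open>W \<noteq> {}\<close> WY obtain w where "w(j := v) \<in> E" by blast
          then have "w(j := v) \<in> PiE {..<r} (\<lambda>_. K)" using EP by blast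
          then have "(w(j := v)) j \<in> K" by (rule PiE_mem) (use j in simp)
          then show "v \<in> fixed_field (q ^ t)" by (simp add: K_def Q_def)
        qed
        show "a = a'" if aa: "a \<in> \<alpha> j ` W" "a' \<in> \<alpha> j ` W" "a' \<in> conjugates (q ^ t) a" for a a'
        proof -
          obtain w w' where w: "w \<in> W" "a = \<alpha> j w" and w': "w' \<in> W" "a' = \<alpha> j w'"
            using aa by blast
          \<comment> \<open>All tuples of \<open>E\<close> carry the same vector of colours, so
            conjugate values of \<open>\<alpha> j\<close> on \<open>W\<close> coincide.\<close>
          have ci: "conjugate_index Q (\<alpha> j u) = snd y j" if "u \<in> W" for u
          proof -
            have "f (u(j := y0)) = y" using WY y0 that fE by blast
            then have "snd y j = conjugate_index Q (\<alpha> j (u(j := y0)))" using j by (auto simp: f_def)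
            then show ?thesis by (simp add: \<alpha>_upd)
          qed
          show ?thesis
            by (rule conjugate_index_inj[of _ Q r]) (use w w' wL r q2 aa ci in \<open>auto simp: L_def Q_def\<close>)
        qed
        show "field_norm q (t * r) (v - a) = b" if av: "a \<in> \<alpha> j ` W" "v \<in> Y" for a v
        proof -
          obtain w where w: "w \<in> W" "a = \<alpha> j w" using av by blast
          have "f (w(j := v)) = y" using WY av w fE by blast
          then have "fst y = field_norm q (t * r) (s (w(j := v)))" by (auto simp: f_def)
          also have "\<dots> = field_norm q (t * r) (\<theta> j) * field_norm q (t * r) (v - a)"
            by (simp add: s_eq[OF j] \<alpha>_upd w field_norm_mult)
          finally show ?thesis
            using \<theta>0[OF j] by (simp add: b_def field_norm_def)
        qed
      qed
      then show ?thesis .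
    qed simp
  qed
qed

section \<open>The algebraic closure of the field with two elements\<close>

instance alg_closure :: (field) field_gcd ..

lemma CHAR_bit: "CHAR(bit) = 2"
proof (rule CHAR_eqI)
  show "2 dvd n" if "of_nat n = (0::bit)" for n
    using that by (metis even_of_nat even_zero)
qed simp

section \<open>From tuples to hypergraphs\<close>

text \<open>The parts are \<open>r\<close> disjoint copies of \<open>K\<close>, placed among the
  \<open>n\<close> vertices by \<open>\<phi>\<close>; the remaining vertices are isolated. A
  forbidden copy is translated back into tuples that violate \<open>bound\<close>.\<close>

lemma hypergraph_of_tuples:
  fixes E :: "(nat \<Rightarrow> 'v) set" and K :: "'v set"
  assumes r: "r \<ge> 2" and t: "t > 0" and s: "s > b" and K: "finite K" "r * card K \<le> n"
    and E: "E \<subseteq> PiE {..<r} (\<lambda>_. K)"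
    and bound: "\<And>j W Y. j < r \<Longrightarrow> finite W \<Longrightarrow> card W = t \<Longrightarrow> (\<And>w y. w \<in> W \<Longrightarrow> y \<in> Y \<Longrightarrow> w(j := y) \<in> E) \<Longrightarrow>
      (\<And>w w'. w \<in> W \<Longrightarrow> w' \<in> W \<Longrightarrow> w \<noteq> w' \<Longrightarrow> \<exists>i<r. i \<noteq> j \<and> w i \<noteq> w' i) \<Longrightarrow> card Y \<le> b"
  shows "\<exists>G :: nat hypergraph. r_graph r G \<and> card (hverts G) = n \<and>
    \<not> contains_copy G (complete_bipartite r s t) \<and> card (hedges G) = card E"
proof -
  have "card (K \<times> {..<r}) \<le> card {..<n}" using K by (simp add: card_cartesian_product mult.commute)
  then obtain \<phi> where \<phi>: "inj_on \<phi> (K \<times> {..<r})" "\<phi> ` (K \<times> {..<r}) \<subseteq> {..<n}"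
    using card_le_inj[of "K \<times> {..<r}" "{..<n}"] K by auto
  define edge where "edge = (\<lambda>x. (\<lambda>i. \<phi> (x i, i)) ` {..<r})"
  define G :: "nat hypergraph" where "G = ({..<n}, edge ` E)"
  have xK: "x i \<in> K" if "x \<in> E" "i < r" for x i using that E by auto
  have \<phi>_eq: "v = v' \<and> i = i'" if "\<phi> (v, i) = \<phi> (v', i')" "v \<in> K" "v' \<in> K" "i < r" "i' < r" for v v' i i'
    using inj_onD[OF \<phi>(1) that(1)] that by auto
  have edgeD: "v = x i" if "\<phi> (v, i) \<in> edge x" "x \<in> E" "v \<in> K" "i < r" for v x i
    using that \<phi>_eq xK by (fastforce simp: edge_def)
  have inj_edge: "inj_on edge E"
  proof (rule inj_onI)
    fix x y assume xy: "x \<in> E" "y \<in> E" "edge x = edge y"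
    have "x i = y i" if "i < r" for i
    proof (rule edgeD)
      show "\<phi> (x i, i) \<in> edge y" unfolding xy(3)[symmetric] using that by (auto simp: edge_def)
    qed (use xy xK that in auto)
    then show "x = y" using xy E by (intro PiE_ext[of x "{..<r}" "\<lambda>_. K" y]) auto
  qed
  have card_edge: "card (edge x) = r" if "x \<in> E" for x
    unfolding edge_def by (subst card_image) (use \<phi>_eq xK that in \<open>auto intro!: inj_onI\<close>)
  have "r_graph r G"
    unfolding r_graph_def G_def using card_edge \<phi>(2) xK by (auto simp: edge_def image_subset_iff)
  moreover have "\<not> contains_copy G (complete_bipartite r s t)"
  proof
    assume "contains_copy G (complete_bipartite r s t)"
    then obtain f where finj: "inj_on f ((\<Union>i<t. X_part r i) \<union> Y_part s)"
      and f_edges: "\<forall>e\<in>{X_part r i \<union> {y} | i y. i < t \<and> y \<in> Y_part s}. f ` e \<in> edge ` E"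
      unfolding contains_copy_def complete_bipartite_def G_def fst_conv snd_conv by blast
    have fE: "f ` (X_part r i \<union> {Inr y}) \<in> edge ` E" if "i < t" "y < s" for i y
      by (rule bspec[OF f_edges]) (use that in \<open>auto simp: Y_part_def\<close>)
    define X where "X = (\<lambda>i. f ` X_part r i)"
    define u where "u = (\<lambda>y. f (Inr y))"
    \<comment> \<open>\<open>x i y\<close> is the tuple behind the edge formed by the images of
      \<open>X_part r i\<close> and \<open>Inr y\<close>.\<close>
    have "\<exists>x. \<forall>i y. i < t \<longrightarrow> y < s \<longrightarrow> x i y \<in> E \<and> edge (x i y) = insert (u y) (X i)"
    proof -
      have "\<exists>w. i < t \<longrightarrow> y < s \<longrightarrow> w \<in> E \<and> edge w = insert (u y) (X i)" for i y
        using fE[of i y] by (auto simp: X_def u_def)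
      then show ?thesis by metis
    qed
    then obtain x where xE: "\<And>i y. i < t \<Longrightarrow> y < s \<Longrightarrow> x i y \<in> E"
      and edge_x: "\<And>i y. i < t \<Longrightarrow> y < s \<Longrightarrow> edge (x i y) = insert (u y) (X i)" by blast
    have inX: "Inl (i, k) \<in> (\<Union>i<t. X_part r i) \<union> Y_part s" if "i < t" "k < r - 1" for i k
      using that by (auto simp: X_part_def)
    have inY: "Inr y \<in> (\<Union>i<t. X_part r i) \<union> Y_part s" if "y < s" for y
      using that by (auto simp: Y_part_def)
    have u_inj: "y = y'" if "u y = u y'" "y < s" "y' < s" for y y'
      using inj_onD[OF finj that(1)[unfolded u_def] inY inY] that by simp
    have uX: "u y \<notin> X i" if "y < s" "i < t" for y i
    proof
      assume "u y \<in> X i"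
      then obtain k where "k < r - 1" "f (Inr y) = f (Inl (i, k))" by (auto simp: X_def u_def X_part_def)
      then show False using inj_onD[OF finj _ inY inX] that by blast
    qed
    have X_disj: "X i \<inter> X i' = {}" if "i < t" "i' < t" "i \<noteq> i'" for i i'
    proof (rule ccontr)
      assume "X i \<inter> X i' \<noteq> {}"
      then obtain k k' where "k < r - 1" "k' < r - 1" "f (Inl (i, k)) = f (Inl (i', k'))"
        by (auto simp: X_def X_part_def)
      then show False using inj_onD[OF finj _ inX inX] that by blast
    qed
    have s0: "0 < s" using s by simp
    have "u 0 \<in> edge (x 0 0)" using edge_x[of 0 0] t s0 by simp
    then obtain j where j: "j < r" "u 0 = \<phi> (x 0 0 j, j)" by (auto simp: edge_def)
    have X_eq: "X i = (\<lambda>k. \<phi> (x i y k, k)) ` ({..<r} - {k0})"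
      if "i < t" "y < s" "k0 < r" "u y = \<phi> (x i y k0, k0)" for i y k0
    proof -
      have "X i = edge (x i y) - {u y}"
        unfolding edge_x[OF that(1,2)] using uX[OF that(2,1)] by simp
      also have "\<dots> = (\<lambda>k. \<phi> (x i y k, k)) ` ({..<r} - {k0})"
        unfolding edge_def that(4) using \<phi>_eq xK[OF xE[OF that(1,2)]] that(3) by (auto simp: image_iff)
      finally show ?thesis .
    qed
    have ex: "\<exists>k0<r. u y = \<phi> (x i y k0, k0)" if "i < t" "y < s" for i y
      using edge_x[of i y] that by (auto simp: edge_def)
    \<comment> \<open>All of \<open>Y\<close> is embedded in a single part \<open>j\<close>, the one that every \<open>X i\<close> misses.\<close>
    have uj: "u y = \<phi> (x i y j, j)" if "i < t" "y < s" for i y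
    proof -
      \<comment> \<open>An edge meets every part exactly once, so \<open>X i\<close> misses just the
        part of the vertex that completes it. Hence this part is the same for all
        \<open>y\<close>.\<close>
      have parts_unique: "k0 = k1"
        if "i < t" "y < s" "y' < s" "k0 < r" "k1 < r" "u y = \<phi> (x i y k0, k0)" "u y' = \<phi> (x i y' k1, k1)"
        for i y y' k0 k1
      proof (rule ccontr)
        assume ne: "k0 \<noteq> k1"
        have "\<phi> (x i y k1, k1) \<in> X i" unfolding X_eq[OF that(1,2,4,6)] using ne that by auto
        then have "\<phi> (x i y k1, k1) \<in> (\<lambda>k. \<phi> (x i y' k, k)) ` ({..<r} - {k1})"
          unfolding X_eq[OF that(1,3,5,7)] .
        then obtain k where k: "k < r" "k \<noteq> k1" "\<phi> (x i y k1, k1) = \<phi> (x i y' k, k)" by auto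
        have "k1 = k"
          using \<phi>_eq[OF k(3) xK[OF xE[OF that(1,2)] that(5)] xK[OF xE[OF that(1,3)] k(1)] that(5) k(1)] by simp
        then show False using k(2) by simp
      qed
      obtain k0 where k0: "k0 < r" "u y = \<phi> (x i y k0, k0)" using ex \<open>i < t\<close> \<open>y < s\<close> by blast
      obtain k1 where k1: "k1 < r" "u 0 = \<phi> (x i 0 k1, k1)" using ex \<open>i < t\<close> s0 by blast
      have "k0 = k1" by (rule parts_unique[OF \<open>i < t\<close> \<open>y < s\<close> s0 k0(1) k1(1) k0(2) k1(2)])
      \<comment> \<open>The vertex \<open>u 0\<close> completes every \<open>X i\<close>, so the
        missed part does not depend on \<open>i\<close> either.\<close>
      moreover have "k1 = j" 
        using \<phi>_eq[of "x i 0 k1" k1 "x 0 0 j" j] k1 j xK[OF xE[OF \<open>i < t\<close> s0] k1(1)] xK[OF xE[OF t s0] j(1)] by simp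
      ultimately show ?thesis using k0 by simp
    qed
    have X_eq': "X i = (\<lambda>k. \<phi> (x i y k, k)) ` ({..<r} - {j})" if "i < t" "y < s" for i y
      by (rule X_eq[OF that j(1) uj[OF that]])
    \<comment> \<open>The entry of \<open>w i\<close> at \<open>j\<close> will be overwritten by
      \<open>v y\<close>; the other entries of \<open>x i y\<close> do not depend on
      \<open>y\<close>.\<close>
    define w where "w = (\<lambda>i. x i 0)"
    define v where "v = (\<lambda>y. x 0 y j)"
    have x_eq: "(w i)(j := v y) = x i y" if i: "i < t" and y: "y < s" for i y
    proof (rule PiE_ext[where k = "{..<r}" and s = "\<lambda>_. K"])
      show xP: "x i y \<in> PiE {..<r} (\<lambda>_. K)" using xE[OF that] E by blast
      have "w i \<in> PiE {..<r} (\<lambda>_. K)" using xE[OF i s0] E by (auto simp: w_def)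
      moreover have "v y \<in> K" using xK[OF xE[OF t y] j(1)] by (simp add: v_def)
      ultimately show "(w i)(j := v y) \<in> PiE {..<r} (\<lambda>_. K)"
        using j(1) by (auto simp: PiE_iff extensional_def)
      fix k assume k: "k \<in> {..<r}"
      show "((w i)(j := v y)) k = x i y k"
      proof (cases "k = j")
        case True
        then show ?thesis
          using \<phi>_eq[of "x 0 y j" j "x i y j" j] uj[OF t y] uj[OF i y] xK[OF xE[OF t y] j(1)] xK[OF xE[OF i y] j(1)] j(1)
          by (simp add: v_def)
      next
        case False
        then have "\<phi> (x i y k, k) \<in> X i" unfolding X_eq'[OF i y] using k by auto
        then obtain k' where k': "k' < r" "\<phi> (x i y k, k) = \<phi> (x i 0 k', k')" unfolding X_eq'[OF i s0] by auto
        have "x i y k = x i 0 k" using \<phi>_eq[OF k'(2)] k' k xK xE i y s0 by auto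
        then show ?thesis using False by (simp add: w_def)
      qed
    qed
    have w_ne: "w i k \<noteq> w i' k" if "i < t" "i' < t" "i \<noteq> i'" "k < r" "k \<noteq> j" for i i' k
    proof
      assume "w i k = w i' k"
      moreover have "\<phi> (w i k, k) \<in> X i" "\<phi> (w i' k, k) \<in> X i'"
        using X_eq'[OF _ s0] that by (auto simp: w_def)
      ultimately show False using X_disj[OF that(1-3)] by auto
    qed
    \<comment> \<open>As \<open>r\<close> is at least 2, there is a coordinate besides
      \<open>j\<close>; there the disjointness of the \<open>X i\<close> makes the
      \<open>w i\<close> differ.\<close>
    obtain k where k: "k < r" "k \<noteq> j"
      using r by (cases "j = 0") (auto intro: that[of 1] that[of 0])
    have "card (v ` {..<s}) \<le> b"
    proof (rule bound[OF j(1), of "w ` {..<t}"])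
      show "card (w ` {..<t}) = t"
      proof (subst card_image)
        show "inj_on w {..<t}"
        proof (rule inj_onI)
          fix i i' assume "i \<in> {..<t}" "i' \<in> {..<t}" "w i = w i'"
          then show "i = i'" using w_ne[of i i' k] k by auto
        qed
      qed simp
      show "w'(j := y) \<in> E" if w': "w' \<in> w ` {..<t}" and y: "y \<in> v ` {..<s}" for w' y
      proof -
        obtain i y' where "i < t" "y' < s" "w' = w i" "y = v y'" using w' y by auto
        then show ?thesis using x_eq xE by simp
      qed
      show "\<exists>i<r. i \<noteq> j \<and> w1 i \<noteq> w2 i" if w12: "w1 \<in> w ` {..<t}" "w2 \<in> w ` {..<t}" "w1 \<noteq> w2" for w1 w2
      proof -
        obtain i i' where "i < t" "i' < t" "w1 = w i" "w2 = w i'" using w12 by auto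
        then show ?thesis using w_ne[of i i' k] k w12(3) by blast
      qed
    qed simp
    moreover have "inj_on v {..<s}"
    proof (rule inj_onI)
      fix y y' assume "y \<in> {..<s}" "y' \<in> {..<s}" "v y = v y'"
      then show "y = y'" using uj[OF t, of y] uj[OF t, of y'] u_inj[of y y'] by (simp add: v_def)
    qed
    ultimately show False using s by (simp add: card_image)
  qed
  moreover have "card (hverts G) = n" "card (hedges G) = card E"
    using inj_edge by (auto simp: G_def card_image)
  ultimately show ?thesis by blast
qed

section \<open>The upper bound\<close>

text \<open>Summing the tangent of the \<open>t\<close>-th power at the mean \<open>a\<close> proves
  the power mean inequality, since the linear terms cancel.\<close>

lemma sum_power_mean:
  fixes d :: "'a \<Rightarrow> real"
  assumes "finite V" "V \<noteq> {}" "\<And>y. y \<in> V \<Longrightarrow> 0 \<le> d y" "t > 0"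
  shows "real (card V) * ((\<Sum>y\<in>V. d y) / card V) ^ t \<le> (\<Sum>y\<in>V. d y ^ t)"
proof -
  define a where "a = (\<Sum>y\<in>V. d y) / card V"
  have a0: "a \<ge> 0" unfolding a_def using assms by (intro divide_nonneg_nonneg sum_nonneg) auto
  have tangent: "a ^ t + t * a ^ (t - 1) * (d y - a) \<le> d y ^ t" if "y \<in> V" for y
  proof (cases "a = 0")
    case True
    then show ?thesis using assms(3)[OF that] assms(4) by (cases "t = 1") (auto simp: power_0_left)
  next
    case False
    then have a: "a > 0" using a0 by simp
    \<comment> \<open>Scaled by \<open>a ^ t\<close>, Bernoulli's inequality at
      \<open>d y / a - 1\<close>, which is at least -1, is the tangent estimate.\<close>
    have "1 + t * (d y / a - 1) \<le> (1 + (d y / a - 1)) ^ t"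
      by (rule Bernoulli_inequality) (use assms(3)[OF that] a in simp)
    then have "a ^ t * (1 + t * (d y / a - 1)) \<le> a ^ t * (d y / a) ^ t"
      using a by (intro mult_left_mono) auto
    moreover have "a ^ t * (d y / a) ^ t = d y ^ t" using a by (simp add: power_divide)
    moreover have "a ^ t * (1 + t * (d y / a - 1)) = a ^ t + t * a ^ (t - 1) * (d y - a)"
    proof -
      have "a ^ t = a ^ (t - 1) * a" using assms(4) by (simp add: power_eq_if)
      then show ?thesis using a by (simp add: field_simps)
    qed
    ultimately show ?thesis by simp
  qed
  have "(\<Sum>y\<in>V. a ^ t + t * a ^ (t - 1) * (d y - a)) = card V * a ^ t + t * a ^ (t - 1) * ((\<Sum>y\<in>V. d y) - card V * a)"
    by (simp add: sum.distrib sum_subtractf flip: sum_distrib_left)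
  also have "\<dots> = card V * a ^ t" using assms by (simp add: a_def)
  finally show ?thesis unfolding a_def[symmetric]
    using sum_mono[of V "\<lambda>y. a ^ t + t * a ^ (t - 1) * (d y - a)" "\<lambda>y. d y ^ t", OF tangent] by simp
qed

section \<open>Counting subsets and tuples of subsets\<close>

lemma card_subsets_le_power:
  assumes "finite V"
  shows "card {X. X \<subseteq> V \<and> card X = k} \<le> card V ^ k"
  using n_subsets[OF assms, of k] binomial_le_pow[of k "card V"]
  by (cases "k \<le> card V") (auto simp: binomial_eq_0)

lemma card_subsets_containing_le_power:
  assumes "finite V" "k > 0"
  shows "card {X. X \<subseteq> V \<and> card X = k \<and> v \<in> X} \<le> card V ^ (k - 1)"
proof -
  have "card {X. X \<subseteq> V \<and> card X = k \<and> v \<in> X} \<le> card {X. X \<subseteq> V \<and> card X = k - 1}"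
  proof (rule card_inj_on_le[of "\<lambda>X. X - {v}"])
    show "inj_on (\<lambda>X. X - {v}) {X. X \<subseteq> V \<and> card X = k \<and> v \<in> X}"
      by (rule inj_onI) (metis (mono_tags) insert_Diff mem_Collect_eq)
  qed (use assms in \<open>auto simp: card_Diff_singleton\<close>)
  then show ?thesis using card_subsets_le_power[OF assms(1), of "k - 1"] by simp
qed

text \<open>There are at most \<open>t ^ 2\<close> pairs of positions and \<open>card V\<close>
  choices of a common element, while forcing this element into two of the sets saves two factors
  \<open>card V\<close>. The net saving of one factor stands on the left to avoid division.\<close>

lemma card_intersecting_tuples:
  fixes V :: "'a set" and k t :: nat
  defines "S \<equiv> {X. X \<subseteq> V \<and> card X = k}"
  assumes V: "finite V" "V \<noteq> {}" and k: "k > 0"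
  shows "card {F \<in> PiE {..<t} (\<lambda>_. S). \<exists>i<t. \<exists>i'<t. i \<noteq> i' \<and> F i \<inter> F i' \<noteq> {}} * card V
    \<le> t ^ 2 * card V ^ (k * t)"
proof -
  define n where "n = card V"
  have n: "n > 0" using V by (simp add: n_def card_gt_0_iff)
  define B where "B = (\<lambda>i i' v. PiE {..<t} (\<lambda>l. if l = i \<or> l = i' then {X \<in> S. v \<in> X} else S))"
  define I where "I = {(i, i'). i < t \<and> i' < t \<and> i \<noteq> i'}"
  have I: "I \<subseteq> {..<t} \<times> {..<t}" by (auto simp: I_def)
  then have fI: "finite I" by (rule finite_subset) simp
  have cI: "card I \<le> t ^ 2"
    using card_mono[OF _ I] by (simp add: card_cartesian_product power2_eq_square)
  have fS: "finite S" using V by (simp add: S_def)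
  have cB: "card (B i i' v) * n ^ 2 \<le> n ^ (k * t)" if "(i, i') \<in> I" for i i' v
  proof -
    have ii: "i < t" "i' < t" "i \<noteq> i'" using that by (auto simp: I_def)
    have Sv: "card {X \<in> S. v \<in> X} * n \<le> n ^ k"
    proof -
      have "{X \<in> S. v \<in> X} = {X. X \<subseteq> V \<and> card X = k \<and> v \<in> X}" by (auto simp: S_def)
      then have "card {X \<in> S. v \<in> X} * n \<le> n ^ (k - 1) * n"
        using card_subsets_containing_le_power[OF V(1) k, of v] by (simp add: n_def)
      then show ?thesis using k by (simp add: power_eq_if mult.commute)
    qed
    have cS: "card S \<le> n ^ k" unfolding S_def n_def by (rule card_subsets_le_power[OF V(1)])
    have "card (B i i' v) = (\<Prod>l<t. card (if l = i \<or> l = i' then {X \<in> S. v \<in> X} else S))"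
      unfolding B_def by (rule card_PiE) simp
    \<comment> \<open>One factor \<open>n\<close> goes to each of the two special positions, so that
      every factor of the product is at most \<open>n ^ k\<close>.\<close>
    moreover have "n ^ 2 = (\<Prod>l<t. if l = i \<or> l = i' then n else 1)"
    proof -
      have "(\<Prod>l<t. if l = i \<or> l = i' then n else 1) = (\<Prod>l\<in>{i, i'}. n)"
        using ii by (intro prod.mono_neutral_cong_right) auto
      then show ?thesis using ii by (simp add: power2_eq_square)
    qed
    ultimately have "card (B i i' v) * n ^ 2 =
      (\<Prod>l<t. card (if l = i \<or> l = i' then {X \<in> S. v \<in> X} else S) * (if l = i \<or> l = i' then n else 1))"
      by (simp add: prod.distrib)
    also have "\<dots> \<le> (\<Prod>l<t. n ^ k)"
      by (intro prod_mono) (use Sv cS in auto)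
    finally show ?thesis by (simp add: power_mult)
  qed
  have "{F \<in> PiE {..<t} (\<lambda>_. S). \<exists>i<t. \<exists>i'<t. i \<noteq> i' \<and> F i \<inter> F i' \<noteq> {}} \<subseteq> (\<Union>(i, i')\<in>I. \<Union>v\<in>V. B i i' v)"
  proof
    fix F assume "F \<in> {F \<in> PiE {..<t} (\<lambda>_. S). \<exists>i<t. \<exists>i'<t. i \<noteq> i' \<and> F i \<inter> F i' \<noteq> {}}"
    then obtain i i' v where F: "F \<in> PiE {..<t} (\<lambda>_. S)" and i: "i < t" "i' < t" "i \<noteq> i'" "v \<in> F i" "v \<in> F i'"
      by blast
    have FS: "F l \<in> S" if "l < t" for l using F that by auto
    have "F \<in> B i i' v" unfolding B_def
      using F FS i by (auto simp: PiE_iff)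
    moreover have "v \<in> V" using FS[OF i(1)] i(4) by (auto simp: S_def)
    ultimately show "F \<in> (\<Union>(i, i')\<in>I. \<Union>v\<in>V. B i i' v)" using i by (auto simp: I_def)
  qed
  moreover have finB: "finite (B i i' v)" for i i' v
    unfolding B_def using fS by (intro finite_PiE) auto
  ultimately have "card {F \<in> PiE {..<t} (\<lambda>_. S). \<exists>i<t. \<exists>i'<t. i \<noteq> i' \<and> F i \<inter> F i' \<noteq> {}}
      \<le> card (\<Union>(i, i')\<in>I. \<Union>v\<in>V. B i i' v)"
    using fI V by (intro card_mono) auto
  also have "\<dots> \<le> (\<Sum>p\<in>I. card (case p of (i, i') \<Rightarrow> \<Union>v\<in>V. B i i' v))"
    by (rule card_UN_le[OF fI])
  also have "\<dots> \<le> (\<Sum>p\<in>I. \<Sum>v\<in>V. card (B (fst p) (snd p) v))"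
    by (rule sum_mono) (auto simp: case_prod_beta intro!: card_UN_le V)
  finally have "card {F \<in> PiE {..<t} (\<lambda>_. S). \<exists>i<t. \<exists>i'<t. i \<noteq> i' \<and> F i \<inter> F i' \<noteq> {}} * n ^ 2
    \<le> (\<Sum>p\<in>I. \<Sum>v\<in>V. card (B (fst p) (snd p) v)) * n ^ 2"
    by (rule mult_le_mono1)
  also have "\<dots> = (\<Sum>p\<in>I. \<Sum>v\<in>V. card (B (fst p) (snd p) v) * n ^ 2)"
    by (simp add: sum_distrib_right)
  also have "\<dots> \<le> (\<Sum>p\<in>I. \<Sum>v\<in>V. n ^ (k * t))"
    by (intro sum_mono cB) auto
  also have "\<dots> \<le> t ^ 2 * (n * n ^ (k * t))" using cI by (simp add: n_def)
  finally show ?thesis using n unfolding n_def[symmetric]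
    by (simp add: power2_eq_square mult_ac) 
qed

text \<open>Common neighbours lie outside every \<open>F i\<close>, so bijections onto the disjoint
  parts and onto \<open>s\<close> neighbours glue to an injection.\<close>

lemma contains_copy_complete_bipartite:
  fixes G :: "'a hypergraph"
  assumes r: "r \<ge> 1" and V: "finite (hverts G)"
    and F: "\<And>i. i < t \<Longrightarrow> F i \<subseteq> hverts G" "\<And>i. i < t \<Longrightarrow> card (F i) = r - 1"
    and disj: "\<And>i i'. i < t \<Longrightarrow> i' < t \<Longrightarrow> i \<noteq> i' \<Longrightarrow> F i \<inter> F i' = {}"
    and N: "N \<subseteq> hverts G" "card N \<ge> s"
    and edge: "\<And>i y. i < t \<Longrightarrow> y \<in> N \<Longrightarrow> y \<notin> F i \<and> insert y (F i) \<in> hedges G"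
  shows "contains_copy G (complete_bipartite r s t)"
proof -
  obtain Y where Y: "Y \<subseteq> N" "card Y = s" using N(2) by (metis obtain_subset_with_card_n)
  have finY: "finite Y" using Y N V by (metis finite_subset)
  have "\<exists>g. bij_betw g {..<s} Y" using finY Y(2) ex_bij_betw_nat_finite[of Y] by (metis lessThan_atLeast0)
  then obtain g where g: "bij_betw g {..<s} Y" by blast
  have "\<exists>h. bij_betw h {..<r - 1} (F i)" if "i < t" for i
    using ex_bij_betw_nat_finite[of "F i"] F[OF that] V by (metis lessThan_atLeast0 finite_subset)
  then have "\<forall>i. \<exists>h. i < t \<longrightarrow> bij_betw h {..<r - 1} (F i)" by blast
  then obtain h where h: "\<And>i. i < t \<Longrightarrow> bij_betw (h i) {..<r - 1} (F i)" by metis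
  define f where "f = case_sum (\<lambda>(i, j). h i j) g"
  have hF: "h i j \<in> F i" if "i < t" "j < r - 1" for i j
    using bij_betwE[OF h[OF that(1)]] that by auto
  have gY: "g j \<in> Y" if "j < s" for j using bij_betwE[OF g] that by auto
  have fX: "f ` X_part r i = F i" if "i < t" for i
  proof -
    have "X_part r i = (\<lambda>j. Inl (i, j)) ` {..<r - 1}" by (auto simp: X_part_def)
    then have "f ` X_part r i = h i ` {..<r - 1}" by (simp add: f_def image_image)
    then show ?thesis using h[OF that] by (simp add: bij_betw_def)
  qed
  show ?thesis unfolding contains_copy_def complete_bipartite_def fst_conv snd_conv
  proof (intro exI[of _ f] conjI ballI)
    have ne: "h i j \<noteq> g k" if "i < t" "j < r - 1" "k < s" for i j k
      using edge[of i "g k"] hF[of i j] gY[of k] Y that by auto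
    have hinj: "i = i' \<and> j = j'" if "h i j = h i' j'" "i < t" "i' < t" "j < r - 1" "j' < r - 1" for i i' j j'
    proof -
      have "i = i'" using disj[of i i'] hF[of i j] hF[of i' j'] that by auto
      then show ?thesis using h[of i] that by (auto simp: bij_betw_def dest: inj_onD)
    qed
    have ginj: "j = j'" if "g j = g j'" "j < s" "j' < s" for j j'
      using g that by (auto simp: bij_betw_def dest: inj_onD)
    show "inj_on f ((\<Union>i<t. X_part r i) \<union> Y_part s)"
    proof (rule inj_onI)
      fix a b assume a: "a \<in> (\<Union>i<t. X_part r i) \<union> Y_part s" and b: "b \<in> (\<Union>i<t. X_part r i) \<union> Y_part s"
        and eq: "f a = f b"
      show "a = b"
      proof (cases a)
        case (Inl p)
        then obtain i j where a': "a = Inl (i, j)" "i < t" "j < r - 1" using a by (auto simp: X_part_def Y_part_def)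
        show ?thesis
        proof (cases b)
          case (Inl p)
          then obtain i' j' where "b = Inl (i', j')" "i' < t" "j' < r - 1" using b by (auto simp: X_part_def Y_part_def)
          then show ?thesis using a' eq hinj[of i j i' j'] by (simp add: f_def)
        next
          case (Inr k)
          then have "k < s" using b by (auto simp: X_part_def Y_part_def)
          then show ?thesis using a' eq ne[of i j k] Inr by (simp add: f_def)
        qed
      next
        case (Inr k)
        then have k: "k < s" using a by (auto simp: X_part_def Y_part_def)
        show ?thesis
        proof (cases b)
          case (Inl p)
          then obtain i' j' where "b = Inl (i', j')" "i' < t" "j' < r - 1" using b by (auto simp: X_part_def Y_part_def)
          then show ?thesis using Inr k eq ne[of i' j' k] by (simp add: f_def)
        next
          case (Inr k')
          then have "k' < s" using b by (auto simp: X_part_def Y_part_def)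
          then show ?thesis using \<open>a = Inr k\<close> k eq ginj[of k k'] Inr by (simp add: f_def)
        qed
      qed
    qed
    have "f ` Y_part s \<subseteq> Y" using gY by (auto simp: f_def Y_part_def)
    with Y(1) N(1) have "f ` Y_part s \<subseteq> hverts G" by simp
    then show "f ` ((\<Union>i<t. X_part r i) \<union> Y_part s) \<subseteq> hverts G"
      using fX F(1) unfolding image_Un image_UN by blast
    fix e assume "e \<in> {X_part r i \<union> {y} | i y. i < t \<and> y \<in> Y_part s}"
    then obtain i k where "i < t" "k < s" "e = X_part r i \<union> {Inr k}" by (auto simp: Y_part_def)
    then show "f ` e \<in> hedges G"
      using edge[of i "g k"] gY[of k] Y fX[of i] by (auto simp: image_Un f_def)
  qed
qed

text \<open>In the constant, \<open>s\<close> accounts for the disjoint tuples and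
  \<open>t ^ 2\<close> for the intersecting ones; a \<open>t\<close>-th root of the double count
  gives the exponent.\<close>

lemma card_edges_le:
  fixes G :: "'a hypergraph"
  assumes r: "r \<ge> 2" and t: "t > 0" and G: "r_graph r G" and n: "card (hverts G) = n" "n > 0"
    and free: "\<not> contains_copy G (complete_bipartite r s t)"
  shows "real (card (hedges G)) \<le> real (s + t ^ 2) powr (1 / t) * real n powr (real r - 1 / real t)"
proof -
  define V where "V = hverts G"
  define S where "S = {X. X \<subseteq> V \<and> card X = r - 1}"
  define D where "D = (\<lambda>y. {X \<in> S. y \<notin> X \<and> insert y X \<in> hedges G})"
  have finV: "finite V" and cV: "card V = n" using G n by (auto simp: V_def r_graph_def)
  have V0: "V \<noteq> {}" using cV n by auto
  have finS: "finite S" using finV by (simp add: S_def)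
  have cS: "card S \<le> n ^ (r - 1)" unfolding S_def using card_subsets_le_power[OF finV] cV by simp
  have finD: "finite (D y)" for y using finS by (simp add: D_def)
  \<comment> \<open>Each edge is charged to one chosen vertex. This gives away a factor
    \<open>r\<close>, which affects only the constant.\<close>
  have e1: "card (hedges G) \<le> (\<Sum>y\<in>V. card (D y))"
  proof -
    have eG: "e \<subseteq> V" "card e = r" if "e \<in> hedges G" for e
      using G that by (auto simp: r_graph_def V_def)
    have ne: "(SOME y. y \<in> e) \<in> e" if "e \<in> hedges G" for e
    proof -
      have "e \<noteq> {}" using eG[OF that] r by auto
      then show ?thesis by (simp add: some_in_eq)
    qed
    have "card (hedges G) \<le> card (Sigma V D)"
    proof (rule card_inj_on_le[of "\<lambda>e. (SOME y. y \<in> e, e - {SOME y. y \<in> e})"])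
      show "inj_on (\<lambda>e. (SOME y. y \<in> e, e - {SOME y. y \<in> e})) (hedges G)"
        by (rule inj_onI) (metis Pair_inject insert_Diff ne)
      show "(\<lambda>e. (SOME y. y \<in> e, e - {SOME y. y \<in> e})) ` hedges G \<subseteq> Sigma V D"
      proof (rule image_subsetI)
        fix e assume e: "e \<in> hedges G"
        then show "(SOME y. y \<in> e, e - {SOME y. y \<in> e}) \<in> Sigma V D"
          using ne[OF e] eG[OF e] by (auto simp: D_def S_def insert_absorb)
      qed
      show "finite (Sigma V D)" using finV finD by simp
    qed
    then show ?thesis using finV finD by simp
  qed
  \<comment> \<open>\<open>N F\<close> is the common neighbourhood of the tuple \<open>F\<close>;
    pairs of a vertex and a tuple are counted from both sides.\<close>
  define N where "N = (\<lambda>F. {y \<in> V. \<forall>i<t. F i \<in> D y})"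
  define P where "P = PiE {..<t} (\<lambda>_. S)"
  define Bad where "Bad = {F \<in> P. \<exists>i<t. \<exists>i'<t. i \<noteq> i' \<and> F i \<inter> F i' \<noteq> {}}"
  have finP: "finite P" unfolding P_def using finS by (intro finite_PiE) auto
  have cP: "card P \<le> n ^ ((r - 1) * t)"
    unfolding P_def using power_mono[OF cS, of t] by (simp add: card_PiE power_mult)
  have "(\<Sum>y\<in>V. card (D y) ^ t) = (\<Sum>y\<in>V. card (PiE {..<t} (\<lambda>_. D y)))" by (simp add: card_PiE)
  also have "\<dots> = card (Sigma V (\<lambda>y. PiE {..<t} (\<lambda>_. D y)))"
    using finV finD by (simp add: finite_PiE)
  also have "\<dots> \<le> card (Sigma P N)"
  proof (rule card_inj_on_le[of prod.swap])
    show "prod.swap ` Sigma V (\<lambda>y. PiE {..<t} (\<lambda>_. D y)) \<subseteq> Sigma P N"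
      by (auto simp: P_def N_def PiE_iff D_def)
    show "finite (Sigma P N)" using finP finV by (simp add: N_def)
  qed simp
  also have "\<dots> = (\<Sum>F\<in>P. card (N F))" using finP finV by (simp add: N_def)
  also have "\<dots> = (\<Sum>F\<in>P - Bad. card (N F)) + (\<Sum>F\<in>Bad. card (N F))"
    by (rule sum.subset_diff) (use finP in \<open>auto simp: Bad_def\<close>)
  also have "\<dots> \<le> s * n ^ ((r - 1) * t) + t ^ 2 * n ^ ((r - 1) * t)"
  proof (rule add_mono)
    have "card (N F) \<le> s" if F: "F \<in> P - Bad" for F
    proof (rule ccontr)
      assume "\<not> card (N F) \<le> s"
      then have Ns: "card (N F) \<ge> s" by simp
      have FS: "F i \<in> S" if "i < t" for i using F that by (auto simp: P_def)
      have "contains_copy G (complete_bipartite r s t)"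
      proof (rule contains_copy_complete_bipartite[of r G t F "N F"])
        show "F i \<inter> F i' = {}" if "i < t" "i' < t" "i \<noteq> i'" for i i'
          using F that by (auto simp: Bad_def)
      qed (use r finV FS Ns in \<open>auto simp: V_def S_def N_def D_def\<close>)
      then show False using free by simp
    qed
    then have "(\<Sum>F\<in>P - Bad. card (N F)) \<le> (\<Sum>F\<in>P - Bad. s)" by (rule sum_mono)
    also have "\<dots> \<le> s * card P" using finP by (simp add: card_mono)
    finally show "(\<Sum>F\<in>P - Bad. card (N F)) \<le> s * n ^ ((r - 1) * t)"
      using cP by (meson le_trans mult_le_mono2)
    have "card (N F) \<le> n" for F
      unfolding cV[symmetric] using finV by (intro card_mono) (auto simp: N_def)
    then have "(\<Sum>F\<in>Bad. card (N F)) \<le> (\<Sum>F\<in>Bad. n)" by (intro sum_mono)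
    also have "\<dots> = card Bad * card V" using cV by simp
    also have "\<dots> \<le> t ^ 2 * n ^ ((r - 1) * t)"
      using card_intersecting_tuples[OF finV V0, of "r - 1" t] r cV
      by (simp add: Bad_def P_def S_def)
    finally show "(\<Sum>F\<in>Bad. card (N F)) \<le> t ^ 2 * n ^ ((r - 1) * t)" .
  qed
  finally have total: "(\<Sum>y\<in>V. card (D y) ^ t) \<le> (s + t ^ 2) * n ^ ((r - 1) * t)"
    by (simp add: distrib_right)
  \<comment> \<open>By \<open>e1\<close>, \<open>x\<close> is a lower bound for the average of
    \<open>card (D y)\<close>, to which the power mean inequality applies.\<close>
  define x where "x = real (card (hedges G)) / n"
  have x0: "x \<ge> 0" by (simp add: x_def)
  have "x \<le> (\<Sum>y\<in>V. real (card (D y))) / n"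
    unfolding x_def using e1 by (intro divide_right_mono) (simp_all flip: of_nat_sum)
  then have "real n * x ^ t \<le> real n * ((\<Sum>y\<in>V. real (card (D y))) / card V) ^ t"
    using x0 cV by (intro mult_left_mono power_mono) auto
  also have "\<dots> \<le> (\<Sum>y\<in>V. real (card (D y)) ^ t)"
    using sum_power_mean[OF finV V0, of "\<lambda>y. real (card (D y))" t] t cV by simp
  also have "\<dots> = real (\<Sum>y\<in>V. card (D y) ^ t)" by simp
  also have "\<dots> \<le> real ((s + t ^ 2) * n ^ ((r - 1) * t))" using total by (rule of_nat_mono)
  finally have main: "real n * x ^ t \<le> real (s + t ^ 2) * real n ^ ((r - 1) * t)" by simp
  have n0: "real n > 0" using n by simp
  have "x ^ t \<le> real (s + t ^ 2) * real n powr (real ((r - 1) * t) - 1)"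
  proof -
    have "real n powr (real ((r - 1) * t) - 1) = real n ^ ((r - 1) * t) / real n"
      using n0 by (simp only: powr_diff powr_realpow powr_one)
    then have "real (s + t ^ 2) * real n powr (real ((r - 1) * t) - 1) = real (s + t ^ 2) * real n ^ ((r - 1) * t) / real n"
      by simp
    then show ?thesis using main n0 by (simp only: pos_le_divide_eq mult.commute[of "x ^ t"])
  qed
  then have "(x ^ t) powr (1 / t) \<le> (real (s + t ^ 2) * real n powr (real ((r - 1) * t) - 1)) powr (1 / t)"
    using x0 by (intro powr_mono2) auto
  moreover have "(x ^ t) powr (1 / t) = x"
    using x0 t by (cases "x = 0") (simp_all add: powr_powr flip: powr_realpow)
  moreover have "(real (s + t ^ 2) * real n powr (real ((r - 1) * t) - 1)) powr (1 / t)
      = real (s + t ^ 2) powr (1 / t) * real n powr (real r - 1 - 1 / t)"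
  proof -
    have "(real ((r - 1) * t) - 1) * (1 / t) = real r - 1 - 1 / t"
      using r t by (simp add: of_nat_diff field_simps)
    then show ?thesis by (simp add: powr_mult powr_powr)
  qed
  ultimately have "x \<le> real (s + t ^ 2) powr (1 / t) * real n powr (real r - 1 - 1 / t)" by simp
  then have "real n * x \<le> real n * (real (s + t ^ 2) powr (1 / t) * real n powr (real r - 1 - 1 / t))"
    by (rule mult_left_mono) simp
  also have "\<dots> = real (s + t ^ 2) powr (1 / t) * (real n powr 1 * real n powr (real r - 1 - 1 / t))"
    using n0 by simp
  also have "real n powr 1 * real n powr (real r - 1 - 1 / t) = real n powr (real r - 1 / t)"
    unfolding powr_add[symmetric] by simp
  finally show ?thesis using n0 by (simp add: x_def)
qed

section \<open>The order of magnitude\<close>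

text \<open>Raising \<open>a\<close> by one multiplies the size by \<open>2 ^ t\<close>, so the
  largest admissible \<open>a\<close> fits \<open>n\<close> up to a constant factor. The lower bound
  on \<open>n\<close> makes \<open>a\<close> positive.\<close>

lemma exists_finite_field_parameter:
  fixes r t n :: nat
  assumes "r > 0" "t > 0" "n \<ge> r * 2 ^ t"
  obtains a where "a > 0" "r * 2 ^ (a * t) \<le> n" "n < r * 2 ^ t * 2 ^ (a * t)"
proof -
  define a where "a = Max {a. r * 2 ^ (a * t) \<le> n}"
  have le: "a \<le> n" if "r * 2 ^ (a * t) \<le> n" for a
  proof -
    have "a < 2 ^ a" by simp
    also have "\<dots> \<le> 2 ^ (a * t)" using assms(2) by (intro power_increasing) auto
    also have "\<dots> \<le> r * 2 ^ (a * t)" using assms(1) by simp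
    finally show ?thesis using that by simp
  qed
  then have fin: "finite {a. r * 2 ^ (a * t) \<le> n}"
    by (intro finite_subset[OF _ finite_atMost[of n]] subsetI) simp
  have 1: "1 \<in> {a. r * 2 ^ (a * t) \<le> n}" using assms(3) by simp
  have "a \<in> {a. r * 2 ^ (a * t) \<le> n}" unfolding a_def by (rule Max_in[OF fin]) (use 1 in blast)
  moreover have "1 \<le> a" unfolding a_def using fin 1 by (rule Max_ge)
  moreover have "n < r * 2 ^ t * 2 ^ (a * t)"
  proof (rule ccontr)
    assume "\<not> n < r * 2 ^ t * 2 ^ (a * t)"
    then have "Suc a \<in> {a. r * 2 ^ (a * t) \<le> n}" by (simp add: power_add mult.assoc)
    then have "Suc a \<le> a" unfolding a_def using fin by (intro Max_ge)
    then show False by simp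
  qed
  ultimately show ?thesis using that[of a] by simp
qed

text \<open>Powers of 2 suffice as values of \<open>q\<close>: replacing \<open>n\<close> by the
  smaller \<open>r * q ^ t\<close> changes the count by a constant factor only.\<close>

lemma dense_hypergraph_exists:
  fixes r s t n :: nat
  assumes r: "r \<ge> 2" and t: "t > 0" and s: "s > (t * r + 1) ^ t" and n: "n \<ge> r * 2 ^ t"
  shows "\<exists>G :: nat hypergraph. r_graph r G \<and> card (hverts G) = n \<and>
    \<not> contains_copy G (complete_bipartite r s t) \<and>
    real n powr (real r - 1 / real t) \<le> (r * 2 ^ t) powr (real r - 1 / real t) * r ^ r * card (hedges G)"
proof -
  obtain a where a: "a > 0" "r * 2 ^ (a * t) \<le> n" "n < r * 2 ^ t * 2 ^ (a * t)"
    using exists_finite_field_parameter[of r t n] assms by auto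
  define q :: nat where "q = 2 ^ a"
  have q: "q \<ge> 2" unfolding q_def using a(1) by (metis self_le_power one_le_numeral)
  have qt: "q ^ t = 2 ^ (a * t)" by (simp add: q_def power_mult)
  have char: "CHAR(bit alg_closure) = 2" by (simp add: CHAR_bit)
  have "\<exists>E :: (nat \<Rightarrow> bit alg_closure) set. E \<subseteq> PiE {..<r} (\<lambda>_. fixed_field (q ^ t)) \<and>
    q ^ (t * r) - 1 \<le> card E * ((q - 1) * r ^ r) \<and>
    (\<forall>j<r. \<forall>W Y. finite W \<longrightarrow> card W = t \<longrightarrow> (\<forall>w\<in>W. \<forall>y\<in>Y. w(j := y) \<in> E) \<longrightarrow>
      (\<forall>w\<in>W. \<forall>w'\<in>W. w \<noteq> w' \<longrightarrow> (\<exists>i<r. i \<noteq> j \<and> w i \<noteq> w' i)) \<longrightarrow> card Y \<le> (t * r + 1) ^ t)"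
    by (rule norm_hypergraph_tuples[where n = a]) (use a t r char in \<open>auto simp: q_def\<close>)
  then obtain E :: "(nat \<Rightarrow> bit alg_closure) set"
    where E: "E \<subseteq> PiE {..<r} (\<lambda>_. fixed_field (q ^ t))"
      and large: "q ^ (t * r) - 1 \<le> card E * ((q - 1) * r ^ r)"
      and bound: "\<And>j W Y. j < r \<Longrightarrow> finite W \<Longrightarrow> card W = t \<Longrightarrow> (\<forall>w\<in>W. \<forall>y\<in>Y. w(j := y) \<in> E) \<Longrightarrow>
        (\<forall>w\<in>W. \<forall>w'\<in>W. w \<noteq> w' \<longrightarrow> (\<exists>i<r. i \<noteq> j \<and> w i \<noteq> w' i)) \<Longrightarrow> card Y \<le> (t * r + 1) ^ t"
    by auto
  have cK: "card (fixed_field (q ^ t) :: bit alg_closure set) = q ^ t"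
    by (rule card_fixed_field[of "a * t"]) (use a t char in \<open>auto simp: qt\<close>)
  have "\<exists>G :: nat hypergraph. r_graph r G \<and> card (hverts G) = n \<and>
    \<not> contains_copy G (complete_bipartite r s t) \<and> card (hedges G) = card E"
  proof (rule hypergraph_of_tuples[OF r t s _ _ E])
    show "finite (fixed_field (q ^ t) :: bit alg_closure set)"
      using cK q by (intro card_ge_0_finite) simp
    show "r * card (fixed_field (q ^ t) :: bit alg_closure set) \<le> n"
      unfolding cK unfolding qt by (rule a(2))
    show "card Y \<le> (t * r + 1) ^ t" if "j < r" "finite W" "card W = t"
      "\<And>w y. w \<in> W \<Longrightarrow> y \<in> Y \<Longrightarrow> w(j := y) \<in> E"
      "\<And>w w'. w \<in> W \<Longrightarrow> w' \<in> W \<Longrightarrow> w \<noteq> w' \<Longrightarrow> \<exists>i<r. i \<noteq> j \<and> w i \<noteq> w' i" for j W Y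
      by (rule bound[OF that(1-3)]) (use that(4,5) in blast)+
  qed
  then obtain G :: "nat hypergraph" where G: "r_graph r G" "card (hverts G) = n"
    "\<not> contains_copy G (complete_bipartite r s t)" "card (hedges G) = card E" by blast
  \<comment> \<open>Fixing a norm costs about a factor \<open>q\<close>, the \<open>t\<close>-th
    root of the part size \<open>q ^ t\<close>. This is the origin of the exponent
    \<open>r - 1 / t\<close>.\<close>
  have dense: "q ^ (t * r - 1) \<le> card E * r ^ r"
  proof -
    have "q ^ (t * r) = q ^ (t * r - 1) * q" using t r by (simp add: power_eq_if)
    then have "q ^ (t * r - 1) * (q - 1) = q ^ (t * r) - q ^ (t * r - 1)"
      by (simp add: diff_mult_distrib2)
    also have "\<dots> \<le> q ^ (t * r) - 1" by (rule diff_le_mono2) (use q in simp)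
    also have "\<dots> \<le> card E * r ^ r * (q - 1)" using large by (simp add: mult_ac)
    finally show ?thesis using q by simp
  qed
  have e: "real r - 1 / real t \<ge> 0"
  proof -
    have "1 / real t \<le> 1" using t by simp
    then show ?thesis using r by linarith
  qed
  have "real n \<le> real (r * 2 ^ t * 2 ^ (a * t))" using a(3) by linarith
  also have "\<dots> = real (r * 2 ^ t) * real q ^ t" by (simp add: qt flip: of_nat_power)
  finally have "real n powr (real r - 1 / real t) \<le> (real (r * 2 ^ t) * real q ^ t) powr (real r - 1 / real t)"
    by (intro powr_mono2 e) auto
  also have "\<dots> = real (r * 2 ^ t) powr (real r - 1 / real t) * (real q ^ t) powr (real r - 1 / real t)"
    by (rule powr_mult)
  also have "(real q ^ t) powr (real r - 1 / real t) = real q ^ (t * r - 1)"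
  proof -
    have "real t * (real r - 1 / real t) = real (t * r - 1)"
      using t r by (simp add: of_nat_diff field_simps)
    moreover have "(real q ^ t) powr (real r - 1 / real t) = real q powr (real t * (real r - 1 / real t))"
      using q by (simp add: powr_powr flip: powr_realpow)
    ultimately show ?thesis using q powr_realpow[of "real q" "t * r - 1"] by simp
  qed
  also have "real (r * 2 ^ t) powr (real r - 1 / real t) * real q ^ (t * r - 1)
    \<le> real (r * 2 ^ t) powr (real r - 1 / real t) * real (card E * r ^ r)"
    using dense by (intro mult_left_mono) (simp_all flip: of_nat_power of_nat_mult)
  finally show ?thesis using G by (intro exI[of _ G]) (simp add: mult_ac)
qed

section \<open>The extremal number as an attained maximum\<close>

lemma ex_ge:
  fixes G :: "nat hypergraph"
  assumes "r_graph r G" "card (hverts G) = n" "\<not> contains_copy G H"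
  shows "card (hedges G) \<le> ex r n H"
  unfolding ex_def by (rule Max_ge[OF finite_ex_set]) (use assms in blast)

lemma ex_attained:
  fixes G0 :: "nat hypergraph"
  assumes "r_graph r G0" "card (hverts G0) = n" "\<not> contains_copy G0 H"
  obtains G :: "nat hypergraph" where "r_graph r G" "card (hverts G) = n" "\<not> contains_copy G H" "card (hedges G) = ex r n H"
proof -
  have "ex r n H \<in> {card (hedges G) | G :: nat hypergraph.
     r_graph r G \<and> card (hverts G) = n \<and> \<not> contains_copy G H}"
    unfolding ex_def by (rule Max_in[OF finite_ex_set]) (use assms in blast)
  then show ?thesis using that by auto
qed

theorem corollary1p4:
  fixes r t :: nat
  assumes "r \<ge> 3" and "t \<ge> 1"
  shows "\<exists>c :: nat. \<forall>s :: nat. s \<ge> c \<longrightarrow>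
    (\<lambda>n :: nat. real (ex r n (complete_bipartite r s t)))
      \<in> \<Theta>[sequentially](\<lambda>n. real n powr (real r - 1 / real t))"
proof (intro exI[of _ "(t * r + 1) ^ t + 1"] allI impI)
  fix s :: nat assume "(t * r + 1) ^ t + 1 \<le> s"
  \<comment> \<open>The threshold is one more than the number of common neighbours that the norm
    construction may allow.\<close>
  then have s: "s > (t * r + 1) ^ t" by simp
  have r: "r \<ge> 2" and t: "t > 0" using assms by auto
  define C where "C = real (r * 2 ^ t) powr (real r - 1 / real t) * real (r ^ r)"
  have C: "C > 0" unfolding C_def using r by (intro mult_pos_pos) auto
  have large: "\<forall>\<^sub>F n in sequentially. n \<ge> r * 2 ^ t" by (rule eventually_ge_at_top)
  have lower: "real n powr (real r - 1 / real t) \<le> C * real (ex r n (complete_bipartite r s t))"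
    and upper: "real (ex r n (complete_bipartite r s t))
      \<le> real (s + t ^ 2) powr (1 / t) * real n powr (real r - 1 / real t)"
    if "n \<ge> r * 2 ^ t" for n
  proof -
    obtain G0 :: "nat hypergraph" where G0: "r_graph r G0" "card (hverts G0) = n"
      "\<not> contains_copy G0 (complete_bipartite r s t)"
      and dense: "real n powr (real r - 1 / real t) \<le> C * real (card (hedges G0))"
      using dense_hypergraph_exists[OF r t s \<open>n \<ge> r * 2 ^ t\<close>] unfolding C_def by auto
    have "real (card (hedges G0)) \<le> real (ex r n (complete_bipartite r s t))"
      using ex_ge[OF G0] by simp
    with C dense show "real n powr (real r - 1 / real t) \<le> C * real (ex r n (complete_bipartite r s t))"
      by (meson less_imp_le mult_left_mono order_trans)
    \<comment> \<open>The graph from the lower bound also shows that the maximum is taken over a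
      nonempty set, so an extremal graph exists.\<close>
    obtain G :: "nat hypergraph" where G: "r_graph r G" "card (hverts G) = n"
      "\<not> contains_copy G (complete_bipartite r s t)" "card (hedges G) = ex r n (complete_bipartite r s t)"
      using ex_attained[OF G0] .
    have "0 < r * 2 ^ t" using r by simp
    then have "n > 0" using that by linarith
    from card_edges_le[OF r t G(1,2) this G(3)]
    show "real (ex r n (complete_bipartite r s t))
      \<le> real (s + t ^ 2) powr (1 / t) * real n powr (real r - 1 / real t)"
      by (simp only: G(4))
  qed
  show "(\<lambda>n. real (ex r n (complete_bipartite r s t))) \<in> \<Theta>[sequentially](\<lambda>n. real n powr (real r - 1 / real t))"
  proof (rule bigthetaI)
    show "(\<lambda>n. real (ex r n (complete_bipartite r s t))) \<in> O[sequentially](\<lambda>n. real n powr (real r - 1 / real t))"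
      by (rule bigoI[of _ "real (s + t ^ 2) powr (1 / t)"], rule eventually_mono[OF large])
        (use upper in simp)
    show "(\<lambda>n. real (ex r n (complete_bipartite r s t))) \<in> \<Omega>[sequentially](\<lambda>n. real n powr (real r - 1 / real t))"
      unfolding bigomega_iff_bigo
      by (rule bigoI[of _ C], rule eventually_mono[OF large]) (use lower in simp)
  qed
qed


end
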